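(* Let $X$ be a partially multiplicative biquandle and let $\Gamma$ be a $Y$-oriented spatial trivalent graph diagram equipped with an $X$-coloring. Let $\Gamma'$ be any ($Y$-oriented) diagram obtained from $\Gamma$ by a single handlebody-knot Reidemeister move. Then there is a unique $X$-coloring of $\Gamma'$ which agrees with the given coloring of $\Gamma$ outside the neighborhood of the move.
   Context: A biquandle is a set $X$ with maps $\underline{\triangleright},\overline{\triangleright}:X\times X\to X$ such that: (i) $x\,\underline{\triangleright}\,x=x\,\overline{\triangleright}\,x$ for all $x$; (ii) for each $y\in X$ the maps $x\mapsto x\,\overline{\triangleright}\,y$ and $x\mapsto x\,\underline{\triangleright}\,y$ are bijections $X\to X$, and $S(x,y)=(y\,\overline{\triangleright}\,x,\ x\,\underline{\triangleright}\,y)$ is a bijection $X\times X\to X\times X$; (iii) for all $x,y,z$: $(x\,\underline{\triangleright}\,y)\,\underline{\triangleright}\,(z\,\underline{\triangleright}\,y)=(x\,\underline{\triangleright}\,z)\,\underline{\triangleright}\,(y\,\overline{\triangleright}\,z)$, $(x\,\underline{\triangleright}\,y)\,\overline{\triangleright}\,(z\,\underline{\triangleright}\,y)=(x\,\overline{\triangleright}\,z)\,\underline{\triangleright}\,(y\,\overline{\triangleright}\,z)$, $(x\,\overline{\triangleright}\,y)\,\overline{\triangleright}\,(z\,\overline{\triangleright}\,y)=(x\,\overline{\triangleright}\,z)\,\overline{\triangleright}\,(y\,\underline{\triangleright}\,z)$. A partially multiplicative biquandle is a biquandle $X$ with a subset $D\subset X\times X$ and a map $D\to X$, $(a,b)\mapsto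 ab$, such that for all elements of $X$: (i) for each fixed $a$ the partial map $x\mapsto ax$, and for each fixed $b$ the partial map $x\mapsto xb$, are injective on their domains; (ii) $(a,b\,\underline{\triangleright}\,a)\in D\Leftrightarrow(b,a\,\overline{\triangleright}\,b)\in D$, and in this case $a(b\,\underline{\triangleright}\,a)=b(a\,\overline{\triangleright}\,b)$; (iii) $(a,b)\in D\Leftrightarrow(a\,\underline{\triangleright}\,x,\,b\,\underline{\triangleright}\,(x\,\overline{\triangleright}\,a))\in D\Leftrightarrow(a\,\overline{\triangleright}\,x,\,b\,\overline{\triangleright}\,(x\,\underline{\triangleright}\,a))\in D$, and in this case $x\,\underline{\triangleright}\,(ab)=(x\,\underline{\triangleright}\,a)\,\underline{\triangleright}\,b$, $(ab)\,\underline{\triangleright}\,x=(a\,\underline{\triangleright}\,x)(b\,\underline{\triangleright}\,(x\,\overline{\triangleright}\,a))$, $x\,\overline{\triangleright}\,(ab)=(x\,\overline{\triangleright}\,a)\,\overline{\triangleright}\,b$, $(ab)\,\overline{\triangleright}\,x=(a\,\overline{\triangleright}\,x)(b\,\overline{\triangleright}\,(x\,\underline{\triangleright}\,a))$; (iv) $(a,b),(ab,c)\in D\Leftrightarrow(b,c),(a,bc)\in D$, and in this case $(ab)c=a(bc)$; (v) [$(a,b),(c,d)\in D$ and $ab=cd$] $\Leftrightarrow$ there exists $e\in X$ with $(a,e),(e,d)\in D$, $ae=c$, $ed=b$. A spatial trivalent graph diagram is a regular planar diagram, with over/under crossing information, of a finite trivalent graph (circle components allowed) embedded in 3-space. A $Y$-orientation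 is a choice of direction of every edge such that no vertex is a source or a sink. Semiarcs are the portions of the diagram between consecutive under-crossing points, over-crossing points and vertices. An $X$-coloring of a $Y$-oriented diagram assigns an element of $X$ to each semiarc such that: - at each crossing, if $x$ is the color of the under-strand semiarc lying to the right of the (oriented) over-strand, and $y$ is the color of the over-strand semiarc lying to the right of the (oriented) under-strand, then the under-strand semiarc to the left of the over-strand has color $x\,\underline{\triangleright}\,y$ and the over-strand semiarc to the left of the under-strand has color $y\,\overline{\triangleright}\,x$; - at each vertex, two of the three edges are both incoming or both outgoing; drawing the vertex locally so that all three edges point upward, if the right one and the left one of these two edges have colors $a$ and $b$ respectively, then $(a,b)\in D$ and the third edge has color $ab$. The handlebody-knot Reidemeister moves, each supported in a disc (the neighborhood of the move) with both sides $Y$-oriented compatibly with the orientation outside the disc, are: the classical Reidemeister moves I, II, III; moving a strand across a vertex, passing entirely over or entirely under it; adding or removing a crossing between two of the edges adjacent to a vertex (twisting the two edges around each other at the vertex); and the IH move, which replaces two vertices joined by a crossingless edge in a disc with four boundary points by the other planar trivalent tree with one internal edge on the same four boundary points. *)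

theory Defs
  imports Main
begin

section \<open>Partially multiplicative biquandles\<close>

text \<open>The underlying set is the type \<open>'x\<close>; \<open>ut\<close> and \<open>ot\<close> are the under- and over-triangle.\<close>

locale biquandle =
  fixes ut :: "'x \<Rightarrow> 'x \<Rightarrow> 'x"  (infixl "\<triangleright>" 70)
    and ot :: "'x \<Rightarrow> 'x \<Rightarrow> 'x"  (infixl "\<unrhd>" 70)
  assumes diag: "x \<triangleright> x = x \<unrhd> x"
    and bij_ot: "bij (\<lambda>x. x \<unrhd> y)"
    and bij_ut: "bij (\<lambda>x. x \<triangleright> y)"
    and bij_S: "bij (\<lambda>(x, y). (y \<unrhd> x, x \<triangleright> y))"
    and exchange_uu: "(x \<triangleright> y) \<triangleright> (z \<triangleright> y) = (x \<triangleright> z) \<triangleright> (y \<unrhd> z)"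
    and exchange_uo: "(x \<triangleright> y) \<unrhd> (z \<triangleright> y) = (x \<unrhd> z) \<triangleright> (y \<unrhd> z)"
    and exchange_oo: "(x \<unrhd> y) \<unrhd> (z \<unrhd> y) = (x \<unrhd> z) \<unrhd> (y \<triangleright> z)"

text \<open>The product is the restriction of the total function \<open>mult\<close> to \<open>D\<close>; no axiom mentions a value
  of \<open>mult\<close> outside \<open>D\<close>.\<close>

locale partially_multiplicative_biquandle = biquandle ut ot
  for ut :: "'x \<Rightarrow> 'x \<Rightarrow> 'x"  (infixl "\<triangleright>" 70)
    and ot :: "'x \<Rightarrow> 'x \<Rightarrow> 'x"  (infixl "\<unrhd>" 70) +
  fixes D :: "('x \<times> 'x) set"
    and mult :: "'x \<Rightarrow> 'x \<Rightarrow> 'x"  (infixl "\<cdot>" 75)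
  assumes inj_left: "inj_on (\<lambda>x. a \<cdot> x) {x. (a, x) \<in> D}"
    and inj_right: "inj_on (\<lambda>x. x \<cdot> b) {x. (x, b) \<in> D}"
    and twist_D: "(a, b \<triangleright> a) \<in> D \<longleftrightarrow> (b, a \<unrhd> b) \<in> D"
    and twist: "(a, b \<triangleright> a) \<in> D \<Longrightarrow> a \<cdot> (b \<triangleright> a) = b \<cdot> (a \<unrhd> b)"
    and ut_D: "(a, b) \<in> D \<longleftrightarrow> (a \<triangleright> x, b \<triangleright> (x \<unrhd> a)) \<in> D"
    and ot_D: "(a, b) \<in> D \<longleftrightarrow> (a \<unrhd> x, b \<unrhd> (x \<triangleright> a)) \<in> D"
    and ut_mult: "(a, b) \<in> D \<Longrightarrow> x \<triangleright> (a \<cdot> b) = (x \<triangleright> a) \<triangleright> b"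
    and mult_ut: "(a, b) \<in> D \<Longrightarrow> (a \<cdot> b) \<triangleright> x = (a \<triangleright> x) \<cdot> (b \<triangleright> (x \<unrhd> a))"
    and ot_mult: "(a, b) \<in> D \<Longrightarrow> x \<unrhd> (a \<cdot> b) = (x \<unrhd> a) \<unrhd> b"
    and mult_ot: "(a, b) \<in> D \<Longrightarrow> (a \<cdot> b) \<unrhd> x = (a \<unrhd> x) \<cdot> (b \<unrhd> (x \<triangleright> a))"
    and assoc_D: "(a, b) \<in> D \<and> (a \<cdot> b, c) \<in> D \<longleftrightarrow> (b, c) \<in> D \<and> (a, b \<cdot> c) \<in> D"
    and assoc: "(a, b) \<in> D \<Longrightarrow> (a \<cdot> b, c) \<in> D \<Longrightarrow> (a \<cdot> b) \<cdot> c = a \<cdot> (b \<cdot> c)"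
    and merge_split: "((a, b) \<in> D \<and> (c, d) \<in> D \<and> a \<cdot> b = c \<cdot> d) \<longleftrightarrow>
      (\<exists>e. (a, e) \<in> D \<and> (e, d) \<in> D \<and> a \<cdot> e = c \<and> e \<cdot> d = b)"

section \<open>Oriented diagrams and tangles\<close>

text \<open>A semiarc \<open>e\<close> runs from its end \<open>Tail e\<close> to its end \<open>Head e\<close>; so \<open>Tail e\<close> is outgoing and
  \<open>Head e\<close> incoming at the node where it lies.\<close>

datatype 'e dart = is_tail: Tail (semiarc: 'e) | is_head: Head (semiarc: 'e)

fun opposite :: "'e dart \<Rightarrow> 'e dart" where
  "opposite (Tail e) = Head e"
| "opposite (Head e) = Tail e"

text \<open>The arguments of a crossing are the incoming and outgoing under-strand semiarcs and the incoming
  and outgoing over-strand semiarcs; at a positive (negative) crossing the over-strand passes from left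
  to right (right to left) of the under-strand. The arguments of \<open>Merge\<close> (two edges come in) and
  \<open>Split\<close> (two edges go out) are the right and the left one of the two, all edges pointing upward,
  and then the third edge. These are all the vertices that are neither sources nor sinks.\<close>

datatype 'e node =
    PosX (under_in: 'e) (under_out: 'e) (over_in: 'e) (over_out: 'e)
  | NegX (under_in: 'e) (under_out: 'e) (over_in: 'e) (over_out: 'e)
  | Merge (right: 'e) (left: 'e) (third: 'e)
  | Split (right: 'e) (left: 'e) (third: 'e)

text \<open>The ends at a node in counterclockwise order, beginning with the incoming under-strand end at a
  crossing and with the third edge at a vertex.\<close>

fun ccw :: "'e node \<Rightarrow> 'e dart list" where
  "ccw (PosX ui uo oi oo) = [Head ui, Tail oo, Tail uo, Head oi]"
| "ccw (NegX ui uo oi oo) = [Head ui, Head oi, Tail uo, Tail oo]"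
| "ccw (Merge r l t) = [Tail t, Head l, Head r]"
| "ccw (Split r l t) = [Head t, Tail r, Tail l]"

text \<open>A tangle is a part of a diagram that is bounded by a circle, either inside or outside of it.
  The list \<open>bd\<close> contains the ends lying on that circle, in the counterclockwise order of their
  positions on the circle; a diagram is a tangle without such ends.
  Semiarcs with no end at a node or on the circle are circle components.\<close>

record 'e tangle =
  arcs :: "'e set"
  nodes :: "'e node set"
  bd :: "'e dart list"

definition attached :: "'e tangle \<Rightarrow> 'e dart set" where
  "attached T = (\<Union>n\<in>nodes T. set (ccw n)) \<union> set (bd T)"

definition is_tangle :: "'e tangle \<Rightarrow> bool" where
  "is_tangle T \<longleftrightarrow>
     finite (arcs T) \<and> finite (nodes T) \<and>
     semiarc ` attached T \<subseteq> arcs T \<and>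
     opposite ` attached T = attached T \<and>
     distinct (bd T) \<and>
     (\<forall>n\<in>nodes T. distinct (ccw n) \<and> set (ccw n) \<inter> set (bd T) = {}) \<and>
     (\<forall>n\<in>nodes T. \<forall>m\<in>nodes T. n \<noteq> m \<longrightarrow> set (ccw n) \<inter> set (ccw m) = {})"

text \<open>Planarity of diagrams, and of tangles outside a circle, whose disc is shrunk to one more node with
  the ends \<open>bd T\<close>: Euler's formula \<open>V + F = E + 2 C\<close>, where \<open>F\<close> counts the boundary cycles of faces and
  \<open>C\<close> the connected components. Since \<open>V - E + F \<le> 2\<close> on each component, it says that every component is
  planar. The relative position of different components is not recorded; colorings do not depend
  on it.\<close>

definition rot :: "'e tangle \<Rightarrow> 'e dart rel" where
  "rot T = {(w ! i, w ! (Suc i mod length w)) | w i. w \<in> insert (bd T) (ccw ` nodes T) \<and> i < length w}"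

definition flip :: "'e tangle \<Rightarrow> 'e dart rel" where
  "flip T = {(d, opposite d) | d. d \<in> attached T}"

definition planar :: "'e tangle \<Rightarrow> bool" where
  "planar T \<longleftrightarrow>
     card (attached T // (rot T)\<^sup>*) + card (attached T // (flip T O rot T)\<^sup>*)
     = card (attached T // (flip T)\<^sup>*) + 2 * card (attached T // (rot T \<union> flip T)\<^sup>*)"

definition diagram :: "'e tangle \<Rightarrow> bool" where
  "diagram G \<longleftrightarrow> is_tangle G \<and> bd G = [] \<and> planar G"

section \<open>Colorings\<close>

text \<open>At a positive crossing the semiarcs \<open>under_in\<close> and \<open>over_out\<close> lie to the right of the other
  strand, at a negative crossing \<open>under_out\<close> and \<open>over_in\<close> do.\<close>

fun colored_node ::
  "('x \<Rightarrow> 'x \<Rightarrow> 'x) \<Rightarrow> ('x \<Rightarrow> 'x \<Rightarrow> 'x) \<Rightarrow> ('x \<times> 'x) set \<Rightarrow> ('x \<Rightarrow> 'x \<Rightarrow> 'x) \<Rightarrow> ('e \<Rightarrow> 'x) \<Rightarrow> 'e node \<Rightarrow> bool"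
where
  "colored_node ut ot D mult c (PosX ui uo oi oo) \<longleftrightarrow>
     c uo = ut (c ui) (c oo) \<and> c oi = ot (c oo) (c ui)"
| "colored_node ut ot D mult c (NegX ui uo oi oo) \<longleftrightarrow>
     c ui = ut (c uo) (c oi) \<and> c oo = ot (c oi) (c uo)"
| "colored_node ut ot D mult c (Merge r l t) \<longleftrightarrow> (c r, c l) \<in> D \<and> c t = mult (c r) (c l)"
| "colored_node ut ot D mult c (Split r l t) \<longleftrightarrow> (c r, c l) \<in> D \<and> c t = mult (c r) (c l)"

text \<open>A coloring is a function on \<open>arcs G\<close>; it is \<open>undefined\<close> elsewhere, so that equality of colorings
  is equality on \<open>arcs G\<close>.\<close>

definition coloring ::
  "('x \<Rightarrow> 'x \<Rightarrow> 'x) \<Rightarrow> ('x \<Rightarrow> 'x \<Rightarrow> 'x) \<Rightarrow> ('x \<times> 'x) set \<Rightarrow> ('x \<Rightarrow> 'x \<Rightarrow> 'x) \<Rightarrow> 'e tangle \<Rightarrow> ('e \<Rightarrow> 'x) \<Rightarrow> bool"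
where
  "coloring ut ot D mult G c \<longleftrightarrow>
     (\<forall>e. e \<notin> arcs G \<longrightarrow> c e = undefined) \<and> (\<forall>n\<in>nodes G. colored_node ut ot D mult c n)"

section \<open>Gluing a tangle into a disc\<close>

text \<open>\<open>glue E T G f g\<close>: the diagram \<open>G\<close> consists of the tangle \<open>T\<close> inside a disc and the tangle \<open>E\<close>
  outside of it, joined at the points of the boundary circle. A semiarc of \<open>G\<close> may be cut by the circle
  into several pieces; \<open>f\<close> and \<open>g\<close> send a semiarc of \<open>E\<close> or of \<open>T\<close> to the semiarc of \<open>G\<close> containing it,
  and pieces are identified exactly as forced by the joints.\<close>

definition joints :: "'o tangle \<Rightarrow> 't tangle \<Rightarrow> ('o + 't) rel" where
  "joints E T = {(Inl (semiarc (bd E ! i)), Inr (semiarc (bd T ! i))) | i. i < length (bd E)}"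

definition glue :: "'o tangle \<Rightarrow> 't tangle \<Rightarrow> 'e tangle \<Rightarrow> ('o \<Rightarrow> 'e) \<Rightarrow> ('t \<Rightarrow> 'e) \<Rightarrow> bool" where
  "glue E T G f g \<longleftrightarrow>
     list_all2 (\<lambda>d d'. is_head d \<noteq> is_head d') (bd E) (bd T) \<and>
     arcs G = f ` arcs E \<union> g ` arcs T \<and>
     nodes G = map_node f ` nodes E \<union> map_node g ` nodes T \<and>
     bd G = [] \<and>
     (\<forall>p \<in> arcs E <+> arcs T. \<forall>q \<in> arcs E <+> arcs T.
        case_sum f g p = case_sum f g q \<longleftrightarrow> (p, q) \<in> (joints E T \<union> (joints E T)\<inverse>)\<^sup>*)"

section \<open>The moves\<close>

text \<open>Unoriented pictures in a disc. The semiarcs are numbered; \<open>UX i j k l\<close> is a crossing with the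
  semiarcs \<open>i, j, k, l\<close> in counterclockwise order where \<open>i, k\<close> belong to the under-strand,
  \<open>UV i j k\<close> is a vertex with the semiarcs \<open>i, j, k\<close> in counterclockwise order. The second component
  lists the semiarcs ending on the boundary circle in counterclockwise order.\<close>

datatype unode = UX nat nat nat nat | UV nat nat nat

type_synonym picture = "unode list \<times> nat list"

fun underlying :: "nat node \<Rightarrow> unode \<Rightarrow> bool" where
  "underlying n (UX i j k l) \<longleftrightarrow> map semiarc (ccw n) \<in> {[i, j, k, l], [k, l, i, j]}"
| "underlying n (UV i j k) \<longleftrightarrow> map semiarc (ccw n) \<in> {[i, j, k], [j, k, i], [k, i, j]}"

text \<open>\<open>T\<close> is the picture \<open>P\<close> with some \<open>Y\<close>-orientation.\<close>

definition orients :: "nat tangle \<Rightarrow> picture \<Rightarrow> bool" where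
  "orients T P \<longleftrightarrow>
     is_tangle T \<and>
     (\<exists>ns. nodes T = set ns \<and> list_all2 underlying ns (fst P)) \<and>
     map semiarc (bd T) = snd P \<and>
     arcs T = semiarc ` attached T"

text \<open>The pictures are considered up to rotation of the disc (rotating the disc amounts to
  choosing another first point on its boundary) and the moves may be read in both directions.\<close>

definition reidemeister1 :: "(picture \<times> picture) set" where
  "reidemeister1 =
    {(([], [0, 0]), ([UX 0 1 1 2], [0, 2])),
     (([], [0, 0]), ([UX 0 2 1 1], [0, 2]))}"

definition reidemeister2 :: "(picture \<times> picture) set" where
  "reidemeister2 =
    {(([], [0, 1, 1, 0]), ([UX 1 2 4 0, UX 4 2 5 3], [0, 1, 5, 3]))}"

text \<open>The strand \<open>0, 1, 2\<close> passes over the crossing of the strands \<open>3, 4, 5\<close> and \<open>6, 7, 8\<close>. Rotations by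
  multiples of 60 degrees lead to the other height orders of the three strands (exchanging the two
  sides of the move for odd multiples).\<close>

definition reidemeister3 :: "(picture \<times> picture) set" where
  "reidemeister3 =
    {(([UX 4 2 5 1, UX 7 1 8 0, UX 6 4 7 3], [0, 3, 6, 2, 5, 8]),
      ([UX 3 1 4 0, UX 6 2 7 1, UX 7 5 8 4], [0, 3, 6, 2, 5, 8])),
     (([UX 4 2 5 1, UX 7 1 8 0, UX 3 6 4 7], [0, 3, 6, 2, 5, 8]),
      ([UX 3 1 4 0, UX 6 2 7 1, UX 4 7 5 8], [0, 3, 6, 2, 5, 8]))}"

text \<open>A strand (first over, then under) crosses one edge at the vertex, or the two others.\<close>

definition vertex_pass :: "(picture \<times> picture) set" where
  "vertex_pass =
    {(([UV 4 5 2, UX 2 1 3 0], [0, 4, 5, 1, 3]),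
      ([UV 4 6 7, UX 3 1 4 0, UX 5 2 6 1], [0, 3, 5, 2, 7])),
     (([UV 4 5 2, UX 0 2 1 3], [0, 4, 5, 1, 3]),
      ([UV 4 6 7, UX 0 3 1 4, UX 1 5 2 6], [0, 3, 5, 2, 7]))}"

definition vertex_twist :: "(picture \<times> picture) set" where
  "vertex_twist =
    {(([UV 0 1 2], [0, 1, 2]), ([UV 3 4 2, UX 1 4 3 0], [0, 1, 2])),
     (([UV 0 1 2], [0, 1, 2]), ([UV 3 4 2, UX 0 1 4 3], [0, 1, 2]))}"

definition IH_move :: "(picture \<times> picture) set" where
  "IH_move =
    {(([UV 0 1 4, UV 2 3 4], [0, 1, 2, 3]), ([UV 1 2 4, UV 3 0 4], [0, 1, 2, 3]))}"

definition moves :: "(picture \<times> picture) set" where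
  "moves = reidemeister1 \<union> reidemeister2 \<union> reidemeister3 \<union> vertex_pass \<union> vertex_twist \<union> IH_move"

text \<open>\<open>G'\<close> is obtained from \<open>G\<close> by a single move in a disc with exterior \<open>E\<close>; \<open>f\<close> and \<open>f'\<close> send the
  semiarcs of the exterior to the semiarcs of \<open>G\<close> and of \<open>G'\<close> containing them. As the ends in \<open>bd E\<close>
  are directed, the orientations on both sides of the move fit the same orientation outside.\<close>

definition single_move ::
  "'e tangle \<Rightarrow> 'f tangle \<Rightarrow> 'o tangle \<Rightarrow> ('o \<Rightarrow> 'e) \<Rightarrow> ('o \<Rightarrow> 'f) \<Rightarrow> bool"
where
  "single_move G G' E f f' \<longleftrightarrow>
     is_tangle E \<and> planar E \<and>
     (\<exists>P P' T T' g g'. (P, P') \<in> moves \<union> moves\<inverse> \<and> orients T P \<and> orients T' P' \<and>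
        glue E T G f g \<and> glue E T' G' f' g')"

end

theory Submission
  imports Defs
begin

text \<open>Cut both diagrams along the boundary circle of the disc in which the move takes place. A
  coloring of a glued diagram amounts to colorings of the two tangles that agree at the joints
  (\<open>coloring_restrict\<close>, \<open>coloring_glue\<close>). The outer tangle keeps its coloring, so everything happens
  inside the disc: if the two sides of a move are oriented in the same way at the circle, then
  the same colors on the circle extend to colorings of either side (\<open>boundary_colorings_move\<close>),
  and they do so in only one way (\<open>determined\<close>).

  At a crossing, one known color on each of the two strands, on whichever side, determines the
  two remaining colors; this is what the three bijectivity axioms say together (\<open>crossing_ex\<close>,
  \<open>crossing_unique\<close>). It contains the second Reidemeister move. The first one needs in addition
  that \<open>S (x, y)\<close> lies on the diagonal only if \<open>x = y\<close> (\<open>S_diagonal\<close>). For the third one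
  (\<open>triangle_move\<close>), one of the two implications consists of the exchange laws for half of the
  orientations; as the colors at three of the six ends extend uniquely to either side,
  everything else follows.

  The moves with vertices come in many orientations: either side of an IH move has 18, and even
  with the directions at the circle fixed, its inner edge may have two. What makes one
  computation per move sufficient is that the partial product is a groupoid: every element that
  takes part in a product has identities on both sides and an inverse. Axiom (v) yields an
  identity between two factors (\<open>middle_ident\<close>), and inverses once all identities exist. The
  identity to the left of a left factor and the one to the right of a right factor come from the
  twist axiom (ii), in the first case together with the injectivity of \<open>S\<close> (\<open>left_ident_if_right\<close>).
  Reversing an edge that ends at a vertex then means inverting its color, both at vertices and
  at crossings (\<open>reverse_over\<close>, \<open>reverse_under\<close>). So all edges may be directed towards the vertex,
  where the condition says that the product of the three colors is an identity, independently of
  where it starts (\<open>cycle_rotate\<close>). In this form a twist at a vertex is axiom (ii), a strand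
  passing a vertex is axiom (iii), and the IH move is axiom (v).\<close>

section \<open>Crossings\<close>

context biquandle
begin

lemma S_inj: "y \<unrhd> x = y' \<unrhd> x' \<Longrightarrow> x \<triangleright> y = x' \<triangleright> y' \<Longrightarrow> x = x' \<and> y = y'"
  using injD[OF bij_is_inj[OF bij_S], of "(x, y)" "(x', y')"] by simp

lemma S_surj: obtains x y where "y \<unrhd> x = v" "x \<triangleright> y = u"
proof -
  have "(v, u) \<in> range (\<lambda>(x, y). (y \<unrhd> x, x \<triangleright> y))"
    using bij_S unfolding bij_def by simp
  then show thesis using that by auto
qed

lemma ut_cancel [simp]: "x \<triangleright> y = x' \<triangleright> y \<longleftrightarrow> x = x'"
  using bij_ut[of y] unfolding bij_def inj_on_def by blast

lemma ot_cancel [simp]: "x \<unrhd> y = x' \<unrhd> y \<longleftrightarrow> x = x'"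
  using bij_ot[of y] unfolding bij_def inj_on_def by blast

lemma ut_surj: obtains x where "x \<triangleright> y = z"
  using bij_ut[of y] by (metis bij_pointE)

lemma ot_surj: obtains x where "x \<unrhd> y = z"
  using bij_ot[of y] by (metis bij_pointE)

text \<open>By the first exchange law, \<open>x\<close> and \<open>y\<close> act in the same way by \<open>\<triangleright>\<close>; hence \<open>S\<close> takes the same value at
  \<open>(x, x)\<close> and at \<open>(x, y)\<close>.\<close>

lemma S_diagonal:
  assumes "y \<unrhd> x = z" "x \<triangleright> y = z"
  shows "x = y"
proof -
  have "(a \<triangleright> y) \<triangleright> z = (a \<triangleright> x) \<triangleright> z" for a
    using exchange_uu[of a y x] assms by simp
  then have "x \<triangleright> x = z" using assms by simp
  moreover have "x \<unrhd> x = z" using diag[of x] calculation by simp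
  ultimately show ?thesis using S_inj[of y x x x] assms by simp
qed

text \<open>The axioms are symmetric in the two operations. So every result about a strand passing over
  has a counterpart about a strand passing under.\<close>

lemma dual: "biquandle (\<unrhd>) (\<triangleright>)"
proof
  show "bij (\<lambda>(x, y). (y \<triangleright> x, x \<unrhd> y))"
  proof (rule bijI)
    show "inj (\<lambda>(x, y). (y \<triangleright> x, x \<unrhd> y))"
    proof (rule injI, clarify)
      fix x y x' y'
      assume "y \<triangleright> x = y' \<triangleright> x'" "x \<unrhd> y = x' \<unrhd> y'"
      then show "x = x' \<and> y = y'" using S_inj[of x y x' y'] by simp
    qed
    show "surj (\<lambda>(x, y). (y \<triangleright> x, x \<unrhd> y))"
      unfolding surj_def
    proof clarify
      fix v u
      obtain x y where "x \<unrhd> y = u" "y \<triangleright> x = v" by (rule S_surj)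
      then show "\<exists>p. (v, u) = (case p of (x, y) \<Rightarrow> (y \<triangleright> x, x \<unrhd> y))"
        by (intro exI[of _ "(x, y)"]) simp
    qed
  qed
  show "x \<unrhd> x = x \<triangleright> x" for x by (rule diag[symmetric])
  show "bij (\<lambda>x. x \<triangleright> y)" for y by (rule bij_ut)
  show "bij (\<lambda>x. x \<unrhd> y)" for y by (rule bij_ot)
  show "(x \<unrhd> y) \<unrhd> (z \<unrhd> y) = (x \<unrhd> z) \<unrhd> (y \<triangleright> z)" for x y z by (rule exchange_oo)
  show "(x \<unrhd> y) \<triangleright> (z \<unrhd> y) = (x \<triangleright> z) \<unrhd> (y \<triangleright> z)" for x y z by (rule exchange_uo[symmetric])
  show "(x \<triangleright> y) \<triangleright> (z \<triangleright> y) = (x \<triangleright> z) \<triangleright> (y \<unrhd> z)" for x y z by (rule exchange_uu)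
qed

text \<open>One relation for all orientations of a crossing with the under-strand semiarcs \<open>x\<close>, \<open>x'\<close> and the
  over-strand semiarcs \<open>y\<close>, \<open>y'\<close>. The bit \<open>p\<close> says that \<open>x'\<close>, not \<open>x\<close>, lies to the right of the
  over-strand, and \<open>q\<close> says that \<open>y'\<close>, not \<open>y\<close>, lies to the right of the under-strand.\<close>

definition crossing :: "bool \<Rightarrow> bool \<Rightarrow> 'x \<Rightarrow> 'x \<Rightarrow> 'x \<Rightarrow> 'x \<Rightarrow> bool" where
  "crossing p q x x' y y' \<longleftrightarrow>
     (if p then x else x') = (if p then x' else x) \<triangleright> (if q then y' else y) \<and>
     (if q then y else y') = (if q then y' else y) \<unrhd> (if p then x' else x)"

lemma crossing_swap:
  "crossing (\<not> p) q x x' y y' \<longleftrightarrow> crossing p q x' x y y'"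
  "crossing p (\<not> q) x x' y y' \<longleftrightarrow> crossing p q x x' y' y"
  by (auto simp: crossing_def)

lemma crossing_dual: "biquandle.crossing (\<unrhd>) (\<triangleright>) p q x x' y y' \<longleftrightarrow> crossing q p y y' x x'"
  using biquandle.crossing_def[OF dual] by (auto simp: crossing_def)

text \<open>The four cases are the surjectivity of \<open>S\<close> and of the two right translations, and the definition
  itself.\<close>

lemma crossing_ex: obtains x' y' where "crossing p q x x' y y'"
proof (cases p; cases q)
  assume "p" "q"
  obtain x' y' where "y' \<unrhd> x' = y" "x' \<triangleright> y' = x" by (rule S_surj)
  with \<open>p\<close> \<open>q\<close> show thesis by (intro that[of x' y']) (simp add: crossing_def)
next
  assume "p" "\<not> q"
  obtain x' where "x' \<triangleright> y = x" by (rule ut_surj)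
  with \<open>p\<close> \<open>\<not> q\<close> show thesis by (intro that[of x' "y \<unrhd> x'"]) (simp add: crossing_def)
next
  assume "\<not> p" "q"
  obtain y' where "y' \<unrhd> x = y" by (rule ot_surj)
  with \<open>\<not> p\<close> \<open>q\<close> show thesis by (intro that[of "x \<triangleright> y'" y']) (simp add: crossing_def)
next
  assume "\<not> p" "\<not> q"
  then show thesis by (intro that[of "x \<triangleright> y" "y \<unrhd> x"]) (simp add: crossing_def)
qed

lemma crossing_unique:
  assumes "crossing p q x x' y y'" "crossing p q x x'' y y''"
  shows "x' = x'' \<and> y' = y''"
proof (cases "p \<and> q")
  case True
  then have "y' \<unrhd> x' = y'' \<unrhd> x''" "x' \<triangleright> y' = x'' \<triangleright> y''"
    using assms by (simp_all add: crossing_def)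
  then show ?thesis by (rule S_inj)
next
  case False
  then show ?thesis using assms unfolding crossing_def
    by (cases p; cases q; simp; metis ut_cancel ot_cancel)
qed

lemma crossing_determined:
  "crossing p q x x' y y' \<Longrightarrow> crossing p q x z y w \<Longrightarrow> x' = z \<and> y' = w"
  "crossing p q x x' y y' \<Longrightarrow> crossing p q z x' y w \<Longrightarrow> x = z \<and> y' = w"
  "crossing p q x x' y y' \<Longrightarrow> crossing p q x z w y' \<Longrightarrow> x' = z \<and> y = w"
  "crossing p q x x' y y' \<Longrightarrow> crossing p q z x' w y' \<Longrightarrow> x = z \<and> y = w"
  using crossing_unique[of p q x x' y y' z w] crossing_unique[of "\<not> p" q x' x y y' z w]
    crossing_unique[of p "\<not> q" x x' y' y z w] crossing_unique[of "\<not> p" "\<not> q" x' x y' y z w]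
  by (simp_all add: crossing_swap)

text \<open>The color \<open>z\<close> of the loop occurs on both strands, on the same side of both.\<close>

lemma kink_eq:
  assumes "crossing p p x z y z"
  shows "x = y"
proof (cases p)
  case True
  have "z \<unrhd> z = x" "z \<triangleright> z = y" using assms True by (auto simp: crossing_def diag)
  then show ?thesis by (simp add: diag)
next
  case False
  have "y \<unrhd> x = z" and "x \<triangleright> y = z" using assms False by (auto simp: crossing_def split: if_splits)
  then show ?thesis by (rule S_diagonal)
qed

lemma kink_ex: obtains z where "crossing p p x z x z"
proof (cases p)
  case True
  obtain a b where "b \<unrhd> a = x" "a \<triangleright> b = x" by (rule S_surj)
  then show thesis using True that[of a] S_diagonal[of b a x] by (auto simp: crossing_def)
next
  case False
  then show thesis using that[of "x \<triangleright> x"] by (auto simp: crossing_def diag)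
qed

text \<open>The first Reidemeister move. In the second version the loop is attached to the other end of
  the over-strand.\<close>

lemma kink_move: "(\<exists>z. crossing p p x z y z) \<longleftrightarrow> x = y"
  using kink_eq kink_ex by metis

lemma kink_move': "(\<exists>z. crossing (\<not> p) p x z z y) \<longleftrightarrow> x = y"
  using kink_move[of "\<not> p" x y] by (simp add: crossing_swap)

text \<open>The second Reidemeister move: read from the inner semiarcs \<open>x'\<close> and \<open>y'\<close>, both crossings are the
  same relation.\<close>

lemma undo_move:
  "(\<exists>y' x'. crossing p q x x' y y' \<and> crossing (\<not> p) q x' x'' y'' y') \<longleftrightarrow> x'' = x \<and> y'' = y"
proof -
  obtain x' y' where "crossing p q x x' y y'" by (rule crossing_ex)
  then show ?thesis using crossing_determined(4) unfolding crossing_swap by metis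
qed

text \<open>Three strands at different heights that cross each other; \<open>t1\<close>, \<open>m1\<close>, \<open>b1\<close> color the sides of the
  inner triangle on the top, middle and bottom strand, and the bits \<open>\<tau>\<close>, \<open>\<mu>\<close>, \<open>\<beta>\<close> say that the
  triangle lies to the right of these strands. Of the two outer ends of a strand, the unprimed
  one is at the crossing with the higher one of the other two strands. On the other side of the
  third Reidemeister move the ends are interchanged and the triangle lies on the other side of
  each strand.\<close>

definition triangle :: "bool \<Rightarrow> bool \<Rightarrow> bool \<Rightarrow> 'x \<Rightarrow> 'x \<Rightarrow> 'x \<Rightarrow> 'x \<Rightarrow> 'x \<Rightarrow> 'x \<Rightarrow> bool" where
  "triangle \<tau> \<mu> \<beta> t m b t' m' b' \<longleftrightarrow> (\<exists>t1 m1 b1.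
     crossing \<tau> \<mu> m m1 t t1 \<and> crossing \<tau> \<beta> b b1 t' t1 \<and> crossing \<mu> \<beta> b' b1 m' m1)"

lemma triangle_unique:
  assumes "triangle \<tau> \<mu> \<beta> t m b t' m' b'" "triangle \<tau> \<mu> \<beta> t m b t'' m'' b''"
  shows "t' = t'' \<and> m' = m'' \<and> b' = b''"
proof -
  obtain t1 m1 b1 where 1: "crossing \<tau> \<mu> m m1 t t1" "crossing \<tau> \<beta> b b1 t' t1"
      "crossing \<mu> \<beta> b' b1 m' m1"
    using assms(1) by (auto simp: triangle_def)
  obtain t2 m2 b2 where 2: "crossing \<tau> \<mu> m m2 t t2" "crossing \<tau> \<beta> b b2 t'' t2"
      "crossing \<mu> \<beta> b'' b2 m'' m2"
    using assms(2) by (auto simp: triangle_def)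
  have *: "m2 = m1" "t2 = t1" using crossing_unique[OF 1(1) 2(1)] by auto
  have **: "b2 = b1" "t'' = t'"
    using crossing_unique[of \<tau> "\<not> \<beta>" b b1 t1 t' b2 t''] 1(2) 2(2) by (auto simp: crossing_swap *)
  show ?thesis
    using crossing_unique[of "\<not> \<mu>" "\<not> \<beta>" b1 b' m1 m' b'' m''] 1(3) 2(3)
        by (auto simp: crossing_swap * **)
qed

text \<open>Complete the crossings one after another, beginning with the one of the middle and bottom
  strands, two of whose ends are \<open>m'\<close> and \<open>b'\<close>.\<close>

lemma triangle_ex:
  obtains t m b where "triangle \<tau> \<mu> \<beta> t m b t' m' b'"
proof -
  obtain b1 m1 where "crossing \<mu> \<beta> b' b1 m' m1" by (rule crossing_ex)
  moreover obtain b t1 where "crossing (\<not> \<tau>) \<beta> b1 b t' t1" by (rule crossing_ex)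
  moreover obtain m t where "crossing (\<not> \<tau>) (\<not> \<mu>) m1 m t1 t" by (rule crossing_ex)
  ultimately have "triangle \<tau> \<mu> \<beta> t m b t' m' b'" by (auto simp: triangle_def crossing_swap)
  then show thesis by (rule that)
qed

text \<open>If the triangle lies to the right of at least two strands, each strand has a segment in this
  picture that is to the right of both other strands. The colors of these three segments express
  all other colors by the two operations, without inverting any bijection, and the exchange laws
  say that the other side of the move leads to the same ends.\<close>

lemma triangle_direct:
  assumes "(\<tau> \<and> \<mu>) \<or> (\<tau> \<and> \<beta>) \<or> (\<mu> \<and> \<beta>)" "triangle \<tau> \<mu> \<beta> t m b t' m' b'"
  shows "triangle (\<not> \<tau>) (\<not> \<mu>) (\<not> \<beta>) t' m' b' t m b"
proof -
  note * = triangle_def crossing_def exchange_uu exchange_uo exchange_oo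
  consider "\<tau>" "\<mu>" "\<beta>" | "\<tau>" "\<mu>" "\<not> \<beta>" | "\<tau>" "\<not> \<mu>" "\<beta>" | "\<not> \<tau>" "\<mu>" "\<beta>"
    using assms(1) by auto
  then show ?thesis using assms(2)
    by cases (clarsimp simp: *)+
qed

text \<open>If the triangle lies to the right of at most one strand, color the opposite side starting from
  the ends \<open>t\<close>, \<open>m\<close>, \<open>b\<close>. The previous lemma applies there and leads back to a coloring of the first
  side with the same three ends, which is unique.\<close>

lemma triangle_move:
  "triangle \<tau> \<mu> \<beta> t m b t' m' b' \<longleftrightarrow> triangle (\<not> \<tau>) (\<not> \<mu>) (\<not> \<beta>) t' m' b' t m b"
proof -
  have "triangle (\<not> \<tau>) (\<not> \<mu>) (\<not> \<beta>) t' m' b' t m b"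
    if *: "triangle \<tau> \<mu> \<beta> t m b t' m' b'" for \<tau> \<mu> \<beta> t m b t' m' b'
  proof (cases "(\<tau> \<and> \<mu>) \<or> (\<tau> \<and> \<beta>) \<or> (\<mu> \<and> \<beta>)")
    case True
    then show ?thesis using * by (rule triangle_direct)
  next
    case False
    obtain t'' m'' b'' where **: "triangle (\<not> \<tau>) (\<not> \<mu>) (\<not> \<beta>) t'' m'' b'' t m b"
        by (rule triangle_ex)
    then have "triangle \<tau> \<mu> \<beta> t m b t'' m'' b''"
      using triangle_direct[OF _ **] False by auto
    with * ** show ?thesis using triangle_unique by blast
  qed
  from this[of \<tau> \<mu> \<beta> t m b t' m' b'] this[of "\<not> \<tau>" "\<not> \<mu>" "\<not> \<beta>" t' m' b' t m b] show ?thesis by auto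
qed

text \<open>The same, with the bits and ends as they arise from the two pictures of the move.\<close>

lemma triangle_move_1:
  "(\<exists>t1 m1 b1. crossing \<tau> \<mu> m1 m' t1 t' \<and> crossing \<tau> \<beta> b1 b' t t1 \<and> crossing (\<not> \<mu>) \<beta> b b1 m m1) \<longleftrightarrow>
   (\<exists>t1 m1 b1. crossing \<tau> \<mu> m m1 t t1 \<and> crossing \<tau> \<beta> b b1 t1 t' \<and> crossing (\<not> \<mu>) \<beta> b1 b' m1 m')"
  using triangle_move[of "\<not> \<tau>" "\<not> \<mu>" \<beta> t' m' b' t m b] by (simp add: triangle_def crossing_swap)

lemma triangle_move_2:
  "(\<exists>t1 b1 m1. crossing \<tau> \<beta> b1 b' t1 t' \<and> crossing \<tau> \<mu> m1 m' t t1 \<and> crossing \<mu> \<beta> b b1 m1 m) \<longleftrightarrow>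
   (\<exists>t1 b1 m1. crossing \<tau> \<beta> b b1 t t1 \<and> crossing \<tau> \<mu> m m1 t1 t' \<and> crossing \<mu> \<beta> b1 b' m' m1)"
  using triangle_move[of "\<not> \<tau>" \<mu> "\<not> \<beta>" t m' b' t' m b]
      by (simp add: triangle_def crossing_swap) metis

end

section \<open>The groupoid of composable elements\<close>

context partially_multiplicative_biquandle
begin

text \<open>The graph of the partial product, so that being defined need not be carried along separately.\<close>

definition product :: "'x \<Rightarrow> 'x \<Rightarrow> 'x \<Rightarrow> bool" where
  "product a b c \<longleftrightarrow> (a, b) \<in> D \<and> a \<cdot> b = c"

lemma product_left_cancel: "product a x c \<Longrightarrow> product a y c \<Longrightarrow> x = y"
  using inj_left[of a] by (auto simp: product_def inj_on_def)

lemma product_right_cancel: "product x b c \<Longrightarrow> product y b c \<Longrightarrow> x = y"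
  using inj_right[of b] by (auto simp: product_def inj_on_def)

lemma product_fun: "product a b c \<Longrightarrow> product a b c' \<Longrightarrow> c = c'"
  by (simp add: product_def)

lemma product_assoc: "product a b x \<Longrightarrow> product x c y \<Longrightarrow> product b c z \<Longrightarrow> product a z y"
  using assoc_D[of a b c] assoc[of a b c] by (auto simp: product_def)

lemma product_assoc': "product b c z \<Longrightarrow> product a z y \<Longrightarrow> product a b x \<Longrightarrow> product x c y"
  using assoc_D[of a b c] assoc[of a b c] by (auto simp: product_def)

text \<open>Axiom (v) from right to left, with \<open>b\<close> as the connecting element \<open>e\<close>.\<close>

lemma product_compose:
  assumes "product a b c" "product b d z"
  obtains y where "product a z y" "product c d y"
  using assms merge_split[of a z c d] by (auto simp: product_def)

lemma product_split:
  assumes "product a b x" "product c d x"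
  obtains e where "product a e c" "product e d b"
  using assms merge_split[of a b c d] by (auto simp: product_def)

definition ident :: "'x \<Rightarrow> bool" where
  "ident e \<longleftrightarrow> product e e e"

text \<open>Axiom (v) for the equation \<open>a \<cdot> b = a \<cdot> b\<close> yields an \<open>e\<close> with \<open>a \<cdot> e = a\<close> and \<open>e \<cdot> b = b\<close>. Cancelling
  \<open>a\<close> in \<open>a \<cdot> (e \<cdot> e) = a \<cdot> e\<close> shows that \<open>e\<close> is idempotent.\<close>

lemma middle_ident:
  assumes "product a b c"
  obtains e where "ident e" "product a e a" "product e b b"
proof -
  obtain e where e: "product a e a" "product e b b"
    using product_split[OF assms assms] .
  obtain y where "product e e y"
    using e product_assoc[of a e a e a] assoc_D[of a e e] by (auto simp: product_def)
  with product_assoc[OF e(1) e(1) this] e(1) have "product e e e"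
    using product_left_cancel by blast
  with e that show thesis by (simp add: ident_def)
qed

text \<open>Acting twice by \<open>e\<close> is the same as acting once, and the action is injective.\<close>

lemma ident_acts_trivially:
  assumes "ident e"
  shows "x \<triangleright> e = x" "x \<unrhd> e = x"
proof -
  have "(x \<triangleright> e) \<triangleright> e = x \<triangleright> e" "(x \<unrhd> e) \<unrhd> e = x \<unrhd> e"
    using assms ut_mult[of e e x] ot_mult[of e e x] by (auto simp: ident_def product_def)
  then show "x \<triangleright> e = x" "x \<unrhd> e = x" by simp_all
qed

lemma product_ut: "product a b c \<longleftrightarrow> product (a \<triangleright> x) (b \<triangleright> (x \<unrhd> a)) (c \<triangleright> x)"
  using mult_ut[of a b x] ut_D[of a b x] by (auto simp: product_def)

lemma product_twist: "product a (b \<triangleright> a) c \<longleftrightarrow> product b (a \<unrhd> b) c"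
  using twist_D[of a b] twist[of a b] by (auto simp: product_def)

text \<open>The hypothesis shows \<open>a\<close> as a left factor only. If \<open>b \<triangleright> a = e\<close>, the twist axiom turns \<open>a \<cdot> e = a\<close>
  into \<open>b \<cdot> w = a\<close> with \<open>w = a \<unrhd> b\<close>. For the identity \<open>k\<close> between \<open>b\<close> and \<open>w\<close> one finds \<open>b \<triangleright> b = k = k \<triangleright> k\<close>,
  so that \<open>S\<close> takes the same value at \<open>(b, b)\<close> and \<open>(k, k)\<close>. Hence \<open>b = k\<close>, which acts trivially, so
  \<open>w = a\<close> and \<open>k \<cdot> a = a\<close>.\<close>

lemma left_ident_if_right:
  assumes "ident e" "product a e a"
  obtains k where "ident k" "product k a a"
proof -
  obtain b where b: "b \<triangleright> a = e" by (rule ut_surj)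
  define w where "w = a \<unrhd> b"
  have w: "product b w a" using assms(2) product_twist[of a b a] b by (simp add: w_def)
  obtain k where k: "ident k" "product b k b" "product k w w" by (rule middle_ident[OF w])
  have "product e (k \<triangleright> w) e"
    using k(2) product_ut[of b k b a] by (simp add: b w_def)
  then have "k \<triangleright> w = e" using assms(1) product_left_cancel by (auto simp: ident_def)
  moreover have "(b \<triangleright> b) \<triangleright> w = e"
    using ut_mult[of b w b] w b by (simp add: product_def)
  ultimately have "b \<triangleright> b = k" by (metis ut_cancel)
  moreover have "k \<triangleright> k = k" by (simp add: ident_acts_trivially k(1))
  ultimately have "b = k"
    using S_inj[of b b k k] by (simp flip: diag)
  moreover have "w = a" using calculation k(1) by (simp add: w_def ident_acts_trivially)
  ultimately show thesis using that k w by blast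
qed

text \<open>On this side the twist axiom suffices, because \<open>e\<close> acts trivially.\<close>

lemma right_ident_if_left:
  assumes "ident e" "product e a a"
  obtains k where "ident k" "product a k a"
proof -
  have "product a (e \<unrhd> a) a"
    using assms product_twist[of e a a] by (simp add: ident_acts_trivially)
  then obtain k where "ident k" "product a k a" by (rule middle_ident)
  then show thesis by (rule that)
qed

text \<open>These are the arrows of the groupoid; its objects are the identities.\<close>

definition composable :: "'x \<Rightarrow> bool" where
  "composable a \<longleftrightarrow> (\<exists>k e. ident k \<and> ident e \<and> product k a a \<and> product a e a)"

lemma composable_if_product:
  assumes "product a b c"
  shows "composable a" "composable b" "composable c"
proof -
  obtain e where e: "ident e" "product a e a" "product e b b" by (rule middle_ident[OF assms])
  obtain k where k: "ident k" "product k a a" by (rule left_ident_if_right[OF e(1,2)])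
  obtain l where l: "ident l" "product b l b" by (rule right_ident_if_left[OF e(1,3)])
  show "composable a" "composable b" using e k l by (auto simp: composable_def)
  have "product k c c" using product_assoc[OF k(2) assms assms] .
  moreover have "product c l c" using product_assoc'[OF l(2) assms assms] .
  ultimately show "composable c" using k l by (auto simp: composable_def)
qed

definition inverses :: "'x \<Rightarrow> 'x \<Rightarrow> bool" where
  "inverses a u \<longleftrightarrow> (\<exists>k e. ident k \<and> ident e \<and> product a u k \<and> product u a e)"

lemma inverses_sym: "inverses a u \<Longrightarrow> inverses u a"
  by (auto simp: inverses_def)

text \<open>Apply axiom (v) to \<open>k \<cdot> a = a \<cdot> e\<close> for the identities \<open>k\<close> and \<open>e\<close> of \<open>a\<close>.\<close>

lemma inverses_ex:
  assumes "composable a"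
  obtains u where "inverses a u"
proof -
  obtain k e where "ident k" "ident e" "product k a a" "product a e a"
    using assms by (auto simp: composable_def)
  moreover from this obtain u where "product a u k" "product u a e" using product_split by blast
  ultimately show thesis using that by (auto simp: inverses_def)
qed

lemma ident_left:
  assumes "ident e" "product e b c" shows "c = b"
  using assms product_assoc[of e e e b c b] product_left_cancel product_assoc
  by (metis ident_def)

lemma ident_right:
  assumes "ident e" "product b e c" shows "c = b"
  using assms product_assoc'[of e e e b c c] product_right_cancel
  by (metis ident_def)

lemma inverse_left:
  assumes "inverses a u" "product a b c"
  shows "product u c b"
proof -
  obtain e where e: "ident e" "product u a e" using assms(1) by (auto simp: inverses_def)
  obtain y where y: "product u c y" "product e b y" by (rule product_compose[OF e(2) assms(2)])
  with e(1) show ?thesis using ident_left by blast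
qed

lemma inverse_right:
  assumes "inverses b u" "product a b c"
  shows "product c u a"
proof -
  obtain e where e: "ident e" "product b u e" using assms(1) by (auto simp: inverses_def)
  obtain y where y: "product a e y" "product c u y" by (rule product_compose[OF assms(2) e(2)])
  with e(1) show ?thesis using ident_right by blast
qed

lemma inverses_unique:
  assumes "inverses a u" "inverses a v"
  shows "u = v"
proof -
  obtain k where "ident k" "product a u k" using assms by (auto simp: inverses_def)
  moreover obtain l where "ident l" "product v a l" using assms by (auto simp: inverses_def)
  moreover obtain y where "product v k y" "product l u y" using product_compose calculation by blast
  ultimately show ?thesis using ident_left ident_right by blast
qed

text \<open>Elements outside the groupoid are left alone, which makes \<open>recip\<close> an involution of the whole
  type.\<close>

definition recip :: "'x \<Rightarrow> 'x" where
  "recip a = (if composable a then THE u. inverses a u else a)"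

lemma recip_eqI:
  assumes "inverses a u"
  shows "recip a = u"
proof -
  have "composable a" using assms composable_if_product by (auto simp: inverses_def)
  then show ?thesis using assms inverses_unique by (auto simp: recip_def intro!: the_equality)
qed

lemma inverses_recip:
  assumes "composable a"
  shows "inverses a (recip a)"
proof -
  obtain u where "inverses a u" by (rule inverses_ex[OF assms])
  then show ?thesis using recip_eqI by simp
qed

lemma composable_recip [simp]: "composable (recip a) \<longleftrightarrow> composable a"
proof (cases "composable a")
  case True
  then show ?thesis using inverses_recip[OF True] composable_if_product by (auto simp: inverses_def)
qed (simp add: recip_def)

lemma recip_recip [simp]: "recip (recip a) = a"
proof (cases "composable a")
  case True
  then show ?thesis using recip_eqI[OF inverses_sym[OF inverses_recip]] by simp
qed (simp add: recip_def)

lemma recip_eq_iff [simp]: "recip a = recip b \<longleftrightarrow> a = b"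
  by (metis recip_recip)

text \<open>In the groupoid this says that \<open>a \<cdot> b \<cdot> c\<close> is an identity. It is the condition on the colors
  around a vertex, read clockwise, when all edges are directed towards the vertex.\<close>

definition cycle :: "'x \<Rightarrow> 'x \<Rightarrow> 'x \<Rightarrow> bool" where
  "cycle a b c \<longleftrightarrow> product a b (recip c)"

lemma cycle_composable:
  assumes "cycle a b c" shows "composable a" "composable b" "composable c"
  using composable_if_product[OF assms[unfolded cycle_def]] by simp_all

lemma cycle_rotate: "cycle a b c \<longleftrightarrow> cycle b c a"
proof -
  have rot: "cycle b c a" if "cycle a b c" for a b c
  proof -
    have "product (recip a) (recip c) b"
      using that inverse_left inverses_recip cycle_composable by (metis cycle_def)
    then have "product b c (recip a)"
      using inverse_right[of "recip c" c "recip a" b] inverses_recip[of "recip c"] that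
          cycle_composable(3)[of a b c]
      by simp
    then show ?thesis by (simp add: cycle_def)
  qed
  then show ?thesis by blast
qed

lemma product_cycle:
  "product a b c \<longleftrightarrow> cycle a b (recip c)"
  by (simp add: cycle_def)

lemma product_cycle_recip:
  "product a b c \<longleftrightarrow> cycle c (recip b) (recip a)"
proof -
  have rot: "product c (recip b) a" if "product a b c" for a b c
    using that composable_if_product inverses_recip inverse_right by blast
  then show ?thesis unfolding cycle_def by (metis recip_recip)
qed

lemma cycle_product: "cycle c b a \<longleftrightarrow> product b a (recip c)"
  using cycle_rotate[of c b a] by (simp add: cycle_def)

section \<open>Reversing the edges at a vertex\<close>

lemma dual_pmb: "partially_multiplicative_biquandle (\<unrhd>) (\<triangleright>) D (\<cdot>)"
proof (intro partially_multiplicative_biquandle.intro dual, unfold_locales)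
  show "(a, b \<unrhd> a) \<in> D \<Longrightarrow> a \<cdot> (b \<unrhd> a) = b \<cdot> (a \<triangleright> b)" for a b
    using twist twist_D by metis
qed (fact inj_left inj_right twist_D[symmetric] ut_D ot_D ut_mult mult_ut ot_mult mult_ot assoc_D
    assoc merge_split)+

lemma composable_ut [simp]: "composable (a \<triangleright> x) \<longleftrightarrow> composable a"
proof
  assume "composable (a \<triangleright> x)"
  then obtain e where "product (a \<triangleright> x) e (a \<triangleright> x)" by (auto simp: composable_def)
  moreover obtain b where "b \<triangleright> (x \<unrhd> a) = e" by (rule ut_surj)
  ultimately have "product a b a" using product_ut by metis
  then show "composable a" by (rule composable_if_product)
next
  assume "composable a"
  then obtain e where "product a e a" by (auto simp: composable_def)
  then show "composable (a \<triangleright> x)" using product_ut composable_if_product by blast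
qed

lemma composable_ot [simp]: "composable (a \<unrhd> x) \<longleftrightarrow> composable a"
  by (rule partially_multiplicative_biquandle.composable_ut[OF dual_pmb])

lemma ident_ut:
  assumes "ident e" shows "ident (e \<triangleright> x)"
  using assms product_ut[of e e e x]
      by (simp add: ident_def[of "e \<triangleright> x"] ident_acts_trivially) (simp add: ident_def)

lemma act_recip:
  assumes "composable a"
  shows "(x \<triangleright> a) \<triangleright> recip a = x" "(x \<unrhd> a) \<unrhd> recip a = x"
proof -
  obtain e where "ident e" "product a (recip a) e"
    using inverses_recip[OF assms] by (auto simp: inverses_def)
  then show "(x \<triangleright> a) \<triangleright> recip a = x" "(x \<unrhd> a) \<unrhd> recip a = x"
    using ut_mult[of a "recip a" x] ot_mult[of a "recip a" x]
        by (auto simp: product_def ident_acts_trivially)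
qed

text \<open>By axiom (iii) the products of \<open>a\<close> with its inverse turn into products of the two elements in
  question, and identities are turned into identities.\<close>

lemma recip_ut:
  assumes "composable a"
  shows "recip (a \<triangleright> x) = recip a \<triangleright> (x \<unrhd> a)"
proof (rule recip_eqI)
  obtain k e where ke: "ident k" "product a (recip a) k" "ident e" "product (recip a) a e"
    using inverses_recip[OF assms] by (auto simp: inverses_def)
  have "product (a \<triangleright> x) (recip a \<triangleright> (x \<unrhd> a)) (k \<triangleright> x)"
    using ke(2) product_ut by blast
  moreover have "product (recip a \<triangleright> (x \<unrhd> a)) (a \<triangleright> x) (e \<triangleright> (x \<unrhd> a))"
    using ke(4) product_ut[of "recip a" a e "x \<unrhd> a"] by (simp add: act_recip assms)
  ultimately show "inverses (a \<triangleright> x) (recip a \<triangleright> (x \<unrhd> a))"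
    using ke ident_ut by (auto simp: inverses_def)
qed

lemma recip_ot:
  assumes "composable a"
  shows "recip (a \<unrhd> x) = recip a \<unrhd> (x \<triangleright> a)"
  using partially_multiplicative_biquandle.recip_ut[OF dual_pmb] assms .

lemma crossing_composable:
  assumes "crossing p q x x' y y'"
  shows "composable x \<longleftrightarrow> composable x'" "composable y \<longleftrightarrow> composable y'"
  using assms by (auto simp: crossing_def split: if_splits)

text \<open>Reversing a strand whose color is composable means inverting its colors: \<open>p\<close> changes because the
  right side of the over-strand becomes its left side.\<close>

lemma reverse_over:
  assumes "composable y"
  shows "crossing p q x x' y y' \<longleftrightarrow> crossing (\<not> p) q x x' (recip y) (recip y')"
proof -
  have 1: "crossing True False x x' (recip y) (recip y')"
    if "crossing False False x x' y y'" "composable y" for x x' y y'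
    using that by (auto simp: crossing_def act_recip recip_ot)
  have 2: "crossing False False x x' (recip y) (recip y')"
    if "crossing True False x x' y y'" "composable y" for x x' y y'
    using 1[of x' x y y'] that crossing_swap(1)[of False False] crossing_swap(1)[of True False]
    by simp
  have 3: "crossing (\<not> p) False x x' (recip y) (recip y')"
    if "crossing p False x x' y y'" "composable y" for p x x' y y'
    using 1 2 that by (cases p) auto
  have 4: "crossing (\<not> p) q x x' (recip y) (recip y')"
    if "crossing p q x x' y y'" "composable y" for p q x x' y y'
    using 3[of p x x' y y'] 3[of p x x' y' y] that crossing_composable[OF that(1)]
      crossing_swap(2)[of _ False]
    by (cases q) auto
  from 4[of p q x x' y y'] 4[of "\<not> p" q x x' "recip y" "recip y'"] assms show ?thesis by auto
qed

lemma reverse_under: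
  assumes "composable x"
  shows "crossing p q x x' y y' \<longleftrightarrow> crossing p (\<not> q) (recip x) (recip x') y y'"
  using partially_multiplicative_biquandle.reverse_over[OF dual_pmb assms, of q p y y' x']
  by (simp add: crossing_dual)

text \<open>The color that a semiarc of color \<open>x\<close> gets when it is directed towards a vertex; the bit \<open>b\<close> says
  that it already is.\<close>

definition flow :: "bool \<Rightarrow> 'x \<Rightarrow> 'x" where
  "flow b x = (if b then x else recip x)"

lemma flow_simps [simp]:
  "flow b (flow b x) = x" "flow (\<not> b) x = recip (flow b x)" "composable (flow b x) \<longleftrightarrow> composable x"
  "flow b x = flow b y \<longleftrightarrow> x = y"
  by (auto simp: flow_def)

lemma ex_flow: "(\<exists>x. P (flow b x)) \<longleftrightarrow> (\<exists>x. P x)"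
  by (metis flow_simps(1))

lemma cycle_determined: "cycle (flow p x) b a \<Longrightarrow> cycle (flow p y) b a \<Longrightarrow> x = y"
  using product_fun[of b a "recip (flow p x)" "recip (flow p y)"] by (simp add: cycle_product)

text \<open>The following lemmas direct the over-strand or the under-strand in a standard way if it is an
  edge at a vertex.\<close>

lemma crossing_flow_over:
  assumes "composable y"
  shows "crossing p q x x' y y' \<longleftrightarrow> crossing True q x x' (flow p y) (flow p y')"
  using reverse_over[OF assms, of p q x x' y'] by (cases p) (auto simp: flow_def)

lemma crossing_flow_under:
  assumes "composable x"
  shows "crossing p q x x' y y' \<longleftrightarrow> crossing p True (flow q x) (flow q x') y y'"
  using reverse_under[OF assms, of p q x' y y'] by (cases q) (auto simp: flow_def)

lemma crossing_flow_iff: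
  assumes "composable x'"
  shows "crossing p q x x' y y' \<longleftrightarrow> crossing p True (flow q x) (flow q x') y y'"
  using crossing_flow_under[of x] crossing_composable(1) assms by (metis flow_simps(3))

lemma crossing_flow_under':
  assumes "composable x"
  shows "crossing p (\<not> q) x x' y y' \<longleftrightarrow> crossing p False (flow q x) (flow q x') y y'"
  using reverse_under[OF assms, of p "\<not> q" x' y y'] by (cases q) (auto simp: flow_def)

lemma crossing_flow_over':
  assumes "composable y"
  shows "crossing (\<not> p) q x x' y y' \<longleftrightarrow> crossing False q x x' (flow p y) (flow p y')"
  using reverse_over[OF assms, of "\<not> p" q x x' y'] by (cases p) (auto simp: flow_def)

section \<open>Moves at vertices\<close>

text \<open>A strand with ends \<open>x\<close> and \<open>y\<close> passes over the third edge of a vertex, or over its two factors,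
  with the color \<open>z\<close> in between. For either value of \<open>s\<close>, axiom (iii) says that the colors on one
  side of the strand yield colors on the other side with the same ends; conversely, the missing
  colors exist because \<open>\<triangleright>\<close> is surjective in its first argument.\<close>

lemma product_pass:
  "(\<exists>r. product b a r \<and> crossing s True r c x y) \<longleftrightarrow>
   (\<exists>a' b' z. product b' a' c \<and> crossing s True a a' x z \<and> crossing s True b b' z y)"
proof (cases s)
  case True
  have "\<exists>a' b'. product b' a' c \<and> a = a' \<triangleright> (y \<unrhd> b') \<and> y \<unrhd> c = (y \<unrhd> b') \<unrhd> a' \<and> b = b' \<triangleright> y"
    if *: "product b a (c \<triangleright> y)"
  proof -
    obtain b' where b': "b' \<triangleright> y = b" by (rule ut_surj)
    obtain a' where a': "a' \<triangleright> (y \<unrhd> b') = a" by (rule ut_surj)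
    have "product b' a' c" using * product_ut[of b' a' c y] a' b' by simp
    then show ?thesis using a' b' ot_mult by (auto simp: product_def)
  qed
  moreover have "product (b' \<triangleright> y) (a' \<triangleright> (y \<unrhd> b')) (c \<triangleright> y) \<and> (y \<unrhd> b') \<unrhd> a' = y \<unrhd> c"
    if "product b' a' c" for a' b'
    using that product_ut[of b' a' c y] ot_mult[of b' a' y] by (auto simp: product_def)
  ultimately show ?thesis using True by (auto simp: crossing_def)
next
  case False
  have "\<exists>r. product b a r \<and> c = r \<triangleright> y \<and> (y \<unrhd> b) \<unrhd> a = y \<unrhd> r"
    if *: "product (b \<triangleright> y) (a \<triangleright> (y \<unrhd> b)) c"
  proof -
    obtain r where r: "r \<triangleright> y = c" by (rule ut_surj)
    have "product b a r" using * product_ut[of b a r y] r by simp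
    then show ?thesis using r ot_mult by (auto simp: product_def)
  qed
  moreover have "product (b \<triangleright> y) (a \<triangleright> (y \<unrhd> b)) (r \<triangleright> y) \<and> (y \<unrhd> b) \<unrhd> a = y \<unrhd> r"
    if "product b a r" for r
    using that product_ut[of b a r y] ot_mult[of b a y] by (auto simp: product_def)
  ultimately show ?thesis using False by (auto simp: crossing_def)
qed

text \<open>Directing the edges \<open>a\<close>, \<open>b\<close>, \<open>c\<close> from the boundary to the vertex makes \<open>c\<close> the inverse of the product
  in the previous lemma.\<close>

lemma over_pass_algebra:
  "(\<exists>r. cycle r b a \<and> crossing s False r c x y) \<longleftrightarrow>
   (\<exists>a' b' z. cycle c b' a' \<and> crossing s True a a' x z \<and> crossing s True b b' z y)"
proof -
  have "(\<exists>r. cycle r b a \<and> crossing s False r c x y) \<longleftrightarrow>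
      (\<exists>r. product b a (recip r) \<and> crossing s True (recip r) (recip c) x y)"
    using reverse_under[of _ s False c x y] cycle_composable by (auto simp: cycle_product)
  also have "\<dots> \<longleftrightarrow> (\<exists>r. product b a r \<and> crossing s True r (recip c) x y)"
    by (metis recip_recip)
  finally show ?thesis unfolding product_pass cycle_product .
qed

lemma over_pass_move:
  "(\<exists>r. cycle (flow d r) (flow b y) (flow a x) \<and> crossing s (\<not> d) r z u v) \<longleftrightarrow>
   (\<exists>w x' y'. cycle (flow d z) (flow b y') (flow a x') \<and> crossing s a x x' u w \<and>
       crossing s b y y' w v)"
  (is "?L \<longleftrightarrow> ?R")
proof -
  have "?L \<longleftrightarrow> (\<exists>r. cycle (flow d r) (flow b y) (flow a x) \<and>
      crossing s False (flow d r) (flow d z) u v)"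
    using crossing_flow_under' cycle_composable(1) by (metis flow_simps(3))
  also have "\<dots> \<longleftrightarrow> (\<exists>r. cycle r (flow b y) (flow a x) \<and> crossing s False r (flow d z) u v)"
    by (rule ex_flow)
  also have "\<dots> \<longleftrightarrow> (\<exists>x' y' w. cycle (flow d z) y' x' \<and> crossing s True (flow a x) x' u w
      \<and> crossing s True (flow b y) y' w v)"
    by (rule over_pass_algebra)
  also have "\<dots> \<longleftrightarrow> (\<exists>x' y' w. cycle (flow d z) (flow b y') (flow a x') \<and>
      crossing s True (flow a x) (flow a x') u w
      \<and> crossing s True (flow b y) (flow b y') w v)"
    by (metis flow_simps(1))
  also have "\<dots> \<longleftrightarrow> ?R"
    using crossing_flow_iff cycle_composable(2,3) by (metis flow_simps(3))
  finally show ?thesis .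
qed

lemma under_pass_move:
  "(\<exists>r. cycle (flow d r) (flow b y) (flow a x) \<and> crossing (\<not> d) s u v z r) \<longleftrightarrow>
   (\<exists>w x' y'. cycle (flow d z) (flow b y') (flow a x') \<and> crossing a s u w x' x \<and>
       crossing b s w v y' y)"
  using partially_multiplicative_biquandle.over_pass_move[OF dual_pmb, of d b y a x "\<not> s" z u v]
  by (simp add: crossing_dual crossing_swap flow_def
      partially_multiplicative_biquandle.flow_def[OF dual_pmb])

text \<open>The crossing turns the edge colors \<open>a = b' \<unrhd> b\<close> and \<open>b\<close> into \<open>b \<triangleright> b'\<close> and \<open>b'\<close>; axiom (ii) says that
  \<open>b' \<cdot> (b \<triangleright> b') = b \<cdot> (b' \<unrhd> b)\<close>.\<close>

lemma twist_algebra: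
  "cycle c b a \<longleftrightarrow> (\<exists>a' b'. cycle c b' a' \<and> crossing False True b a' a b')"
proof -
  obtain b' where b': "b' \<unrhd> b = a" by (rule ot_surj)
  have "cycle c b' (b \<triangleright> b') \<longleftrightarrow> cycle c b a"
    using product_twist[of b' b "recip c"] by (simp add: cycle_product b')
  then show ?thesis using b' by (auto simp: crossing_def)
qed

lemma twist_algebra':
  "cycle c b a \<longleftrightarrow> (\<exists>a' b'. cycle c b' a' \<and> crossing True True a b' a' b)"
proof -
  obtain b' where b': "b' \<triangleright> b = a" by (rule ut_surj)
  have "cycle c b' (b \<unrhd> b') \<longleftrightarrow> cycle c b a"
    using product_twist[of b b' "recip c"] by (simp add: cycle_product b')
  then show ?thesis using b' by (auto simp: crossing_def)
qed

lemma twist_move: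
  "(\<exists>y' x'. cycle (flow d z) (flow a x') (flow b y') \<and> crossing (\<not> a) b y y' x x') \<longleftrightarrow>
   cycle (flow d z) (flow b y) (flow a x)" (is "?L \<longleftrightarrow> ?R")
proof -
  have "?L \<longleftrightarrow> (\<exists>x' y'. cycle (flow d z) (flow a x') (flow b y') \<and>
      crossing False True (flow b y) (flow b y') (flow a x) (flow a x'))"
    using crossing_flow_iff crossing_flow_over' crossing_composable cycle_composable(2,3)
        flow_simps(3)
    by metis
  also have "\<dots> \<longleftrightarrow> (\<exists>x' y'. cycle (flow d z) x' y' \<and> crossing False True (flow b y) y' (flow a x) x')"
    by (metis flow_simps(1))
  also have "\<dots> \<longleftrightarrow> ?R" using twist_algebra by metis
  finally show ?thesis .
qed

lemma twist_move':
  "(\<exists>y' x'. cycle (flow d z) (flow a x') (flow b y') \<and> crossing b a x x' y' y) \<longleftrightarrow>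
   cycle (flow d z) (flow b y) (flow a x)" (is "?L \<longleftrightarrow> ?R")
proof -
  have "?L \<longleftrightarrow> (\<exists>x' y'. cycle (flow d z) (flow a x') (flow b y') \<and>
      crossing True True (flow a x) (flow a x') (flow b y') (flow b y))"
    using crossing_flow_iff crossing_flow_over cycle_composable(2,3) flow_simps(3)
    by metis
  also have "\<dots> \<longleftrightarrow> (\<exists>x' y'. cycle (flow d z) x' y' \<and> crossing True True (flow a x) x' y' (flow b y))"
    by (metis flow_simps(1))
  also have "\<dots> \<longleftrightarrow> ?R" using twist_algebra' by metis
  finally show ?thesis .
qed

text \<open>With \<open>x\<close> eliminated, the condition reads \<open>b \<cdot> a = c\<^sup>-\<^sup>1 \<cdot> d\<^sup>-\<^sup>1\<close>, both being the inverse of \<open>x\<close>. The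
  element that connects these two factorizations by axiom (v) is \<open>y\<close>.\<close>

lemma IH_algebra:
  "(\<exists>x. cycle x b a \<and> cycle (recip x) d c) \<longleftrightarrow> (\<exists>y. cycle y c b \<and> cycle (recip y) a d)"
proof -
  have "\<exists>y. cycle y c b \<and> cycle (recip y) a d" if "cycle x b a" "cycle (recip x) d c" for x a b c d
  proof -
    have "product b a (recip x)" "product (recip c) (recip d) (recip x)"
      using that cycle_rotate product_cycle product_cycle_recip by (metis recip_recip)+
    then obtain e where "product b e (recip c)" "product e (recip d) a" by (rule product_split)
    then have "cycle e c b \<and> cycle (recip e) a d"
      using that cycle_rotate product_cycle product_cycle_recip by (metis recip_recip)
    then show ?thesis by blast
  qed
  from this[of _ b a d c] this[of _ c b a d] this show ?thesis by (metis recip_recip)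
qed

text \<open>The inner edges of the two sides may be directed independently of each other.\<close>

lemma IH_move_algebra:
  "(\<exists>x. cycle (flow e x) b a \<and> cycle (flow (\<not> e) x) d c) \<longleftrightarrow>
   (\<exists>y. cycle (flow e' y) c b \<and> cycle (flow (\<not> e') y) a d)"
  using IH_algebra[of b a d c]
  unfolding flow_simps ex_flow[of "\<lambda>x. cycle x _ _ \<and> cycle (recip x) _ _"] .

end

section \<open>Orientations of pictures\<close>

text \<open>Directions are encoded by bits so that the orientations of a picture can be parametrized; \<open>True\<close>
  means that the semiarc comes in at this end.\<close>

definition end_at :: "bool \<Rightarrow> 'e \<Rightarrow> 'e dart" where
  "end_at b e = (if b then Head e else Tail e)"

lemma end_at_simps [simp]:
  "end_at b e = end_at b' e' \<longleftrightarrow> b = b' \<and> e = e'"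
  "semiarc (end_at b e) = e" "is_head (end_at b e) = b"
  "Head e = end_at b e' \<longleftrightarrow> b \<and> e = e'" "Tail e = end_at b e' \<longleftrightarrow> \<not> b \<and> e = e'"
  by (auto simp: end_at_def)

lemma semiarc_eq_iff: "semiarc d = e \<longleftrightarrow> (\<exists>b. d = end_at b e)"
  by (cases d) (auto simp: end_at_def)

text \<open>The crossing \<open>UX i j k l\<close> with the under-strand running from \<open>i\<close> to \<open>k\<close> if \<open>u\<close>, and the over-strand
  running from \<open>j\<close> to \<open>l\<close> if \<open>v\<close>; in the opposite direction otherwise.\<close>

definition crossing_node :: "bool \<Rightarrow> bool \<Rightarrow> 'e \<Rightarrow> 'e \<Rightarrow> 'e \<Rightarrow> 'e \<Rightarrow> 'e node" where
  "crossing_node u v i j k l =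
     (if u then if v then NegX i k j l else PosX i k l j
      else if v then PosX k i j l else NegX k i l j)"

text \<open>Neither a source nor a sink.\<close>

definition mixed :: "bool \<Rightarrow> bool \<Rightarrow> bool \<Rightarrow> bool" where
  "mixed u v w \<longleftrightarrow> \<not> (u = v \<and> v = w)"

text \<open>The vertex \<open>UV i j k\<close>, where the bits say which of the semiarcs \<open>i\<close>, \<open>j\<close>, \<open>k\<close> come in.\<close>

definition vertex_node :: "bool \<Rightarrow> bool \<Rightarrow> bool \<Rightarrow> 'e \<Rightarrow> 'e \<Rightarrow> 'e \<Rightarrow> 'e node" where
  "vertex_node u v w i j k =
     (if u then if v then Merge j i k else if w then Merge i k j else Split j k i
      else if v then if w then Merge k j i else Split k i j else Split i j k)"

lemma underlying_UX: "underlying n (UX i j k l) \<longleftrightarrow> (\<exists>u v. n = crossing_node u v i j k l)"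
  by (cases n) (auto simp: crossing_node_def)

lemma underlying_UV: "underlying n (UV i j k) \<longleftrightarrow> (\<exists>u v w. mixed u v w \<and> n = vertex_node u v w i j k)"
  by (cases n) (auto simp: vertex_node_def mixed_def)

lemma set_ccw_crossing_node:
  "set (ccw (crossing_node u v i j k l)) =
    {end_at u i, end_at v j, end_at (\<not> u) k, end_at (\<not> v) l}"
  by (auto simp: crossing_node_def end_at_def)

lemma distinct_ccw_crossing:
  "distinct (ccw (crossing_node u v i j k l)) \<longleftrightarrow>
      distinct [end_at u i, end_at v j, end_at (\<not> u) k, end_at (\<not> v) l]"
  by (auto simp: crossing_node_def end_at_def)

lemma set_ccw_vertex_node:
  "mixed u v w \<Longrightarrow>
    set (ccw (vertex_node u v w i j k)) = {end_at u i, end_at v j, end_at w k}"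
  by (auto simp: vertex_node_def mixed_def end_at_def)

lemma distinct_ccw_vertex_node:
  "mixed u v w \<Longrightarrow>
    distinct (ccw (vertex_node u v w i j k)) \<longleftrightarrow> distinct [end_at u i, end_at v j, end_at w k]"
  by (auto simp: vertex_node_def mixed_def end_at_def)

fun unode_arcs :: "unode \<Rightarrow> nat set" where
  "unode_arcs (UX i j k l) = {i, j, k, l}"
| "unode_arcs (UV i j k) = {i, j, k}"

lemma underlying_arcs: "underlying n u \<Longrightarrow> semiarc ` set (ccw n) = unode_arcs u"
proof (cases u)
  case (UX i j k l)
  then show "underlying n u \<Longrightarrow> ?thesis"
      by (auto simp: underlying_UX set_ccw_crossing_node simp del: underlying.simps)
next
  case (UV i j k)
  then show "underlying n u \<Longrightarrow> ?thesis"
      by (auto simp: underlying_UV set_ccw_vertex_node simp del: underlying.simps)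
qed

text \<open>Ends at different nodes of a tangle are different. To conclude this for different places in
  the list \<open>us\<close>, the same node must not occur twice; the hypothesis on \<open>us\<close> excludes it, since each
  entry has a semiarc that is missing in all later ones.\<close>

lemma oriented_nodes:
  assumes "orients T (us, bs)" "sorted_wrt (\<lambda>u v. \<exists>i\<in>unode_arcs u. i \<notin> unode_arcs v) us"
  obtains ns where "nodes T = set ns" "list_all2 underlying ns us" "map semiarc (bd T) = bs"
    "distinct (bd T)" "\<forall>n\<in>set ns. distinct (ccw n) \<and> set (ccw n) \<inter> set (bd T) = {}"
    "sorted_wrt (\<lambda>n m. set (ccw n) \<inter> set (ccw m) = {}) ns"
proof -
  obtain ns where ns: "nodes T = set ns" "list_all2 underlying ns us"
    using assms(1) by (auto simp: orients_def)
  have T: "is_tangle T" "map semiarc (bd T) = bs" using assms(1) by (auto simp: orients_def)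
  have "map (\<lambda>n. semiarc ` set (ccw n)) ns = map unode_arcs us"
    using ns(2) underlying_arcs by (induction rule: list_all2_induct) simp_all
  moreover have "distinct (map unode_arcs us)"
    using assms(2) by (induction us) auto
  ultimately have "distinct ns" by (metis distinct_map)
  moreover have "set (ccw n) \<inter> set (ccw m) = {}" if "n \<in> set ns" "m \<in> set ns" "n \<noteq> m" for n m
    using T(1) that by (auto simp: is_tangle_def ns(1))
  ultimately have "sorted_wrt (\<lambda>n m. set (ccw n) \<inter> set (ccw m) = {}) ns"
    by (simp add: sorted_wrt_iff_nth_less nth_eq_iff_index_eq)
  with that ns T show thesis by (simp add: is_tangle_def)
qed

lemma oriented_arcs:
  assumes "orients T (us, bs)"
  shows "arcs T = \<Union> (unode_arcs ` set us) \<union> set bs"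
proof -
  obtain ns where ns: "nodes T = set ns" "list_all2 underlying ns us"
    using assms(1) by (auto simp: orients_def)
  have "(\<Union>n\<in>set ns. semiarc ` set (ccw n)) = \<Union> (unode_arcs ` set us)"
    using ns(2) underlying_arcs by (induction rule: list_all2_induct) simp_all
  moreover have "arcs T = semiarc ` attached T" "set bs = semiarc ` set (bd T)"
    using assms by (auto simp: orients_def)
  ultimately show ?thesis by (simp add: attached_def ns(1) image_Un image_UN)
qed

lemma map_semiarc_Cons:
  "map semiarc ds = i # is \<longleftrightarrow> (\<exists>b ds'. ds = end_at b i # ds' \<and> map semiarc ds' = is)"
  by (auto simp: map_eq_Cons_conv semiarc_eq_iff)

lemmas oriented_simps = list_all2_Cons2 underlying_UX underlying_UV
  set_ccw_crossing_node set_ccw_vertex_node distinct_ccw_crossing distinct_ccw_vertex_node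
  map_semiarc_Cons

text \<open>Each semiarc of a picture has two ends, exactly one of which is incoming where it lies. This
  leaves one bit for each strand and for each edge at a vertex, and the list of boundary ends
  shows all of them except the one of an edge between two vertices. In the pictures of three
  strands, the bits \<open>t\<close>, \<open>m\<close>, \<open>b\<close> belong to the top, middle and bottom strand.\<close>

lemma oriented_arc:
  assumes "orients T ([], [0, 0])"
  obtains s where "nodes T = {}"
    "bd T = [end_at (\<not> s) 0, end_at s 0]"
  by (rule oriented_nodes[OF assms])
    (simp, auto simp: oriented_simps simp del: underlying.simps)

lemma oriented_kink:
  assumes "orients T ([UX 0 1 1 2], [0, 2])"
  obtains s where "nodes T = {crossing_node s s 0 1 1 2}"
    "bd T = [end_at (\<not> s) 0, end_at s 2]"
  by (rule oriented_nodes[OF assms])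
    (simp, auto simp: oriented_simps simp del: underlying.simps)

lemma oriented_kink':
  assumes "orients T ([UX 0 2 1 1], [0, 2])"
  obtains s where "nodes T = {crossing_node s (\<not> s) 0 2 1 1}"
    "bd T = [end_at (\<not> s) 0, end_at s 2]"
  by (rule oriented_nodes[OF assms])
    (simp, auto simp: oriented_simps simp del: underlying.simps)

lemma oriented_two_arcs:
  assumes "orients T ([], [0, 1, 1, 0])"
  obtains u v where "nodes T = {}"
    "bd T = [end_at v 0, end_at (\<not> u) 1, end_at u 1, end_at (\<not> v) 0]"
  by (rule oriented_nodes[OF assms])
    (simp, auto simp: oriented_simps simp del: underlying.simps)

lemma oriented_two_crossings:
  assumes "orients T ([UX 1 2 4 0, UX 4 2 5 3], [0, 1, 5, 3])"
  obtains u v where "nodes T = {crossing_node u v 1 2 4 0, crossing_node u (\<not> v) 4 2 5 3}"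
    "bd T = [end_at v 0, end_at (\<not> u) 1, end_at u 5, end_at (\<not> v) 3]"
  by (rule oriented_nodes[OF assms])
    (simp, auto simp: oriented_simps simp del: underlying.simps)

lemma oriented_triangle_1:
  assumes "orients T ([UX 4 2 5 1, UX 7 1 8 0, UX 6 4 7 3], [0, 3, 6, 2, 5, 8])"
  obtains t m b where "nodes T = {crossing_node m t 4 2 5 1, crossing_node b t 7 1 8 0,
      crossing_node b (\<not> m) 6 4 7 3}"
    "bd T = [end_at t 0, end_at (\<not> m) 3, end_at (\<not> b) 6, end_at (\<not> t) 2, end_at m 5, end_at b 8]"
  by (rule oriented_nodes[OF assms])
    (simp, auto simp: oriented_simps simp del: underlying.simps)

lemma oriented_triangle_1':
  assumes "orients T ([UX 3 1 4 0, UX 6 2 7 1, UX 7 5 8 4], [0, 3, 6, 2, 5, 8])"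
  obtains t m b where "nodes T = {crossing_node m t 3 1 4 0, crossing_node b t 6 2 7 1,
      crossing_node b (\<not> m) 7 5 8 4}"
    "bd T = [end_at t 0, end_at (\<not> m) 3, end_at (\<not> b) 6, end_at (\<not> t) 2, end_at m 5, end_at b 8]"
  by (rule oriented_nodes[OF assms])
    (simp, auto simp: oriented_simps simp del: underlying.simps)

lemma oriented_triangle_2:
  assumes "orients T ([UX 4 2 5 1, UX 7 1 8 0, UX 3 6 4 7], [0, 3, 6, 2, 5, 8])"
  obtains t m b where "nodes T = {crossing_node b t 4 2 5 1, crossing_node m t 7 1 8 0,
      crossing_node b m 3 6 4 7}"
    "bd T = [end_at t 0, end_at (\<not> b) 3, end_at (\<not> m) 6, end_at (\<not> t) 2, end_at b 5, end_at m 8]"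
  by (rule oriented_nodes[OF assms])
    (simp, auto simp: oriented_simps simp del: underlying.simps)

lemma oriented_triangle_2':
  assumes "orients T ([UX 3 1 4 0, UX 6 2 7 1, UX 4 7 5 8], [0, 3, 6, 2, 5, 8])"
  obtains t m b where "nodes T = {crossing_node b t 3 1 4 0, crossing_node m t 6 2 7 1,
      crossing_node b m 4 7 5 8}"
    "bd T = [end_at t 0, end_at (\<not> b) 3, end_at (\<not> m) 6, end_at (\<not> t) 2, end_at b 5, end_at m 8]"
  by (rule oriented_nodes[OF assms])
    (simp, auto simp: oriented_simps simp del: underlying.simps)

lemma oriented_over_pass:
  assumes "orients T ([UV 4 5 2, UX 2 1 3 0], [0, 4, 5, 1, 3])"
  obtains a b d s where "nodes T = {vertex_node a b d 4 5 2, crossing_node (\<not> d) s 2 1 3 0}"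
    "bd T = [end_at s 0, end_at (\<not> a) 4, end_at (\<not> b) 5, end_at (\<not> s) 1, end_at (\<not> d) 3]"
    "mixed a b d"
  by (rule oriented_nodes[OF assms])
    (simp, auto simp: oriented_simps simp del: underlying.simps)

lemma oriented_over_pass':
  assumes "orients T ([UV 4 6 7, UX 3 1 4 0, UX 5 2 6 1], [0, 3, 5, 2, 7])"
  obtains a b d s where "nodes T = {vertex_node a b d 4 6 7, crossing_node a s 3 1 4 0,
      crossing_node b s 5 2 6 1}"
    "bd T = [end_at s 0, end_at (\<not> a) 3, end_at (\<not> b) 5, end_at (\<not> s) 2, end_at (\<not> d) 7]"
    "mixed a b d"
  by (rule oriented_nodes[OF assms])
    (simp, auto simp: oriented_simps simp del: underlying.simps)

lemma oriented_under_pass: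
  assumes "orients T ([UV 4 5 2, UX 0 2 1 3], [0, 4, 5, 1, 3])"
  obtains a b d s where "nodes T = {vertex_node a b d 4 5 2, crossing_node s (\<not> d) 0 2 1 3}"
    "bd T = [end_at (\<not> s) 0, end_at (\<not> a) 4, end_at (\<not> b) 5, end_at s 1, end_at (\<not> d) 3]"
    "mixed a b d"
  by (rule oriented_nodes[OF assms])
    (simp, auto simp: oriented_simps simp del: underlying.simps)

lemma oriented_under_pass':
  assumes "orients T ([UV 4 6 7, UX 0 3 1 4, UX 1 5 2 6], [0, 3, 5, 2, 7])"
  obtains a b d s where "nodes T = {vertex_node a b d 4 6 7, crossing_node s a 0 3 1 4,
      crossing_node s b 1 5 2 6}"
    "bd T = [end_at (\<not> s) 0, end_at (\<not> a) 3, end_at (\<not> b) 5, end_at s 2, end_at (\<not> d) 7]"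
    "mixed a b d"
  by (rule oriented_nodes[OF assms])
    (simp, auto simp: oriented_simps simp del: underlying.simps)

lemma oriented_vertex:
  assumes "orients T ([UV 0 1 2], [0, 1, 2])"
  obtains a b d where "nodes T = {vertex_node a b d 0 1 2}"
    "bd T = [end_at (\<not> a) 0, end_at (\<not> b) 1, end_at (\<not> d) 2]"
    "mixed a b d"
  by (rule oriented_nodes[OF assms])
    (simp, auto simp: oriented_simps simp del: underlying.simps)

lemma oriented_twist:
  assumes "orients T ([UV 3 4 2, UX 1 4 3 0], [0, 1, 2])"
  obtains a b d where "nodes T = {vertex_node b a d 3 4 2, crossing_node b (\<not> a) 1 4 3 0}"
    "bd T = [end_at (\<not> a) 0, end_at (\<not> b) 1, end_at (\<not> d) 2]"
    "mixed b a d"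
  by (rule oriented_nodes[OF assms])
    (simp, auto simp: oriented_simps simp del: underlying.simps)

lemma oriented_twist':
  assumes "orients T ([UV 3 4 2, UX 0 1 4 3], [0, 1, 2])"
  obtains a b d where "nodes T = {vertex_node b a d 3 4 2, crossing_node a b 0 1 4 3}"
    "bd T = [end_at (\<not> a) 0, end_at (\<not> b) 1, end_at (\<not> d) 2]"
    "mixed b a d"
  by (rule oriented_nodes[OF assms])
    (simp, auto simp: oriented_simps simp del: underlying.simps)

lemma oriented_H:
  assumes "orients T ([UV 0 1 4, UV 2 3 4], [0, 1, 2, 3])"
  obtains a b p q e where "nodes T = {vertex_node a b e 0 1 4, vertex_node p q (\<not> e) 2 3 4}"
    "bd T = [end_at (\<not> a) 0, end_at (\<not> b) 1, end_at (\<not> p) 2, end_at (\<not> q) 3]"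
    "mixed a b e" "mixed p q (\<not> e)"
  by (rule oriented_nodes[OF assms])
    (simp, auto simp: oriented_simps simp del: underlying.simps)

lemma oriented_I:
  assumes "orients T ([UV 1 2 4, UV 3 0 4], [0, 1, 2, 3])"
  obtains a b p q e where "nodes T = {vertex_node b p e 1 2 4, vertex_node q a (\<not> e) 3 0 4}"
    "bd T = [end_at (\<not> a) 0, end_at (\<not> b) 1, end_at (\<not> p) 2, end_at (\<not> q) 3]"
    "mixed b p e" "mixed q a (\<not> e)"
  by (rule oriented_nodes[OF assms])
    (simp, auto simp: oriented_simps simp del: underlying.simps)

section \<open>Colorings of the two sides of a move\<close>

text \<open>The semiarcs of all pictures are among \<open>0, \<dots>, 8\<close>, so that a coloring can be replaced by nine
  separate colors.\<close>

lemma ex_coloring: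
  "(\<exists>c :: nat \<Rightarrow> 'a. P c) \<longleftrightarrow>
   (\<exists>x0 x1 x2 x3 x4 x5 x6 x7 x8 c.
     P (\<lambda>i. if i < 9 then [x0, x1, x2, x3, x4, x5, x6, x7, x8] ! i else c i))"
proof
  assume "\<exists>c. P c"
  then obtain c where "P c" ..
  moreover have "(\<lambda>i. if i < 9 then [c 0, c 1, c 2, c 3, c 4, c 5, c 6, c 7, c 8] ! i else c i) = c"
    by (auto simp: fun_eq_iff less_Suc_eq numeral_eq_Suc)
  ultimately show "\<exists>x0 x1 x2 x3 x4 x5 x6 x7 x8 c.
      P (\<lambda>i. if i < 9 then [x0, x1, x2, x3, x4, x5, x6, x7, x8] ! i else c i)"
    by metis
qed blast

context partially_multiplicative_biquandle
begin

abbreviation colored :: "('e \<Rightarrow> 'x) \<Rightarrow> 'e node \<Rightarrow> bool" where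
  "colored \<equiv> colored_node (\<triangleright>) (\<unrhd>) D (\<cdot>)"

lemma colored_crossing_node:
  "colored_node (\<triangleright>) (\<unrhd>) D m c (crossing_node u v i j k l) \<longleftrightarrow> crossing v u (c i) (c k) (c l) (c j)"
  by (auto simp: crossing_node_def crossing_def)

lemma colored_vertex_node:
  assumes "mixed u v w"
  shows "colored_node (\<triangleright>) (\<unrhd>) D (\<cdot>) c (vertex_node u v w i j k) \<longleftrightarrow>
    cycle (flow w (c k)) (flow v (c j)) (flow u (c i))"
proof -
  have 1: "(a, b) \<in> D \<and> d = a \<cdot> b \<longleftrightarrow> cycle a b (recip d)" for a b d
    by (auto simp: cycle_def product_def)
  have 2: "cycle a b (recip d) \<longleftrightarrow> cycle d (recip b) (recip a)" for a b d
    using product_cycle product_cycle_recip by simp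
  show ?thesis using assms
    by (cases u; cases v; cases w) (simp_all add: vertex_node_def mixed_def flow_def 1,
        (use 2 cycle_rotate in metis)+)
qed

definition boundary_colorings :: "nat tangle \<Rightarrow> 'x list set" where
  "boundary_colorings T = {map (c \<circ> semiarc) (bd T) | c. \<forall>n\<in>nodes T. colored c n}"

definition determined :: "nat tangle \<Rightarrow> bool" where
  "determined T \<longleftrightarrow> (\<forall>c d. (\<forall>n\<in>nodes T. colored c n \<and> colored d n) \<and>
     map (c \<circ> semiarc) (bd T) = map (d \<circ> semiarc) (bd T) \<longrightarrow> (\<forall>e\<in>arcs T. c e = d e))"

lemma boundary_colorings_iff:
  "\<beta> \<in> boundary_colorings T \<longleftrightarrow> (\<exists>x0 x1 x2 x3 x4 x5 x6 x7 x8 d.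
     let c = (\<lambda>i. if i < 9 then [x0, x1, x2, x3, x4, x5, x6, x7, x8] ! i else d i) in
       \<beta> = map (c \<circ> semiarc) (bd T) \<and> (\<forall>n\<in>nodes T. colored c n))"
  unfolding boundary_colorings_def mem_Collect_eq Let_def by (rule ex_coloring)

lemmas boundary_coloring_simps = boundary_colorings_iff Let_def colored_crossing_node
    colored_vertex_node

lemmas determined_simps = determined_def colored_crossing_node colored_vertex_node

lemmas determined_dests = crossing_determined cycle_determined

text \<open>A coloring is determined by its boundary because one can enter the picture at a crossing where
  an end of each strand lies on the circle and proceed from there; in the pictures of the IH
  move the vertex relation determines the inner edge.\<close>

lemma colorings_arc:
  assumes "orients T ([], [0, 0])"
  obtains s where "bd T = [end_at (\<not> s) 0, end_at s 0]"
    "boundary_colorings T =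
      {[x0, x0] | x0. True}"
    "determined T"
  by (rule oriented_arc[OF assms], rule that, assumption, rule set_eqI)
    ((simp add: boundary_coloring_simps; blast),
        auto simp: determined_simps oriented_arcs[OF assms] dest: determined_dests)

lemma colorings_kink:
  assumes "orients T ([UX 0 1 1 2], [0, 2])"
  obtains s where "bd T = [end_at (\<not> s) 0, end_at s 2]"
    "boundary_colorings T =
      {[x0, x2] | x0 x2. \<exists>x1. crossing s s x0 x1 x2 x1}"
    "determined T"
  by (rule oriented_kink[OF assms], rule that, assumption, rule set_eqI)
    ((simp add: boundary_coloring_simps; blast),
        auto simp: determined_simps oriented_arcs[OF assms] dest: determined_dests)

lemma colorings_kink':
  assumes "orients T ([UX 0 2 1 1], [0, 2])"
  obtains s where "bd T = [end_at (\<not> s) 0, end_at s 2]"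
    "boundary_colorings T =
      {[x0, x2] | x0 x2. \<exists>x1. crossing (\<not> s) s x0 x1 x1 x2}"
    "determined T"
  by (rule oriented_kink'[OF assms], rule that, assumption, rule set_eqI)
    ((simp add: boundary_coloring_simps; blast),
        auto simp: determined_simps oriented_arcs[OF assms] dest: determined_dests)

lemma colorings_two_arcs:
  assumes "orients T ([], [0, 1, 1, 0])"
  obtains u v where "bd T = [end_at v 0, end_at (\<not> u) 1, end_at u 1, end_at (\<not> v) 0]"
    "boundary_colorings T =
      {[x0, x1, x1, x0] | x0 x1. True}"
    "determined T"
  by (rule oriented_two_arcs[OF assms], rule that, assumption, rule set_eqI)
    ((simp add: boundary_coloring_simps; blast),
        auto simp: determined_simps oriented_arcs[OF assms] dest: determined_dests)

lemma colorings_two_crossings: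
  assumes "orients T ([UX 1 2 4 0, UX 4 2 5 3], [0, 1, 5, 3])"
  obtains u v where "bd T = [end_at v 0, end_at (\<not> u) 1, end_at u 5, end_at (\<not> v) 3]"
    "boundary_colorings T =
      {[x0, x1, x5, x3] | x0 x1 x5 x3. \<exists>x2 x4. crossing v u x1 x4 x0 x2 \<and>
      crossing (\<not> v) u x4 x5 x3 x2}"
    "determined T"
  by (rule oriented_two_crossings[OF assms], rule that, assumption, rule set_eqI)
    ((simp add: boundary_coloring_simps; blast),
        auto simp: determined_simps oriented_arcs[OF assms] dest: determined_dests)

lemma colorings_triangle_1:
  assumes "orients T ([UX 4 2 5 1, UX 7 1 8 0, UX 6 4 7 3], [0, 3, 6, 2, 5, 8])"
  obtains t m b where "bd T = [end_at t 0, end_at (\<not> m) 3, end_at (\<not> b) 6, end_at (\<not> t) 2,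
      end_at m 5, end_at b 8]"
    "boundary_colorings T =
      {[x0, x3, x6, x2, x5, x8] | x0 x3 x6 x2 x5 x8. \<exists>x1 x4 x7. crossing t m x4 x5 x1 x2 \<and>
      crossing t b x7 x8 x0 x1 \<and>
      crossing (\<not> m) b x6 x7 x3 x4}"
    "determined T"
  by (rule oriented_triangle_1[OF assms], rule that, assumption, rule set_eqI)
    ((simp add: boundary_coloring_simps; blast),
        auto simp: determined_simps oriented_arcs[OF assms] dest: determined_dests)

lemma colorings_triangle_1':
  assumes "orients T ([UX 3 1 4 0, UX 6 2 7 1, UX 7 5 8 4], [0, 3, 6, 2, 5, 8])"
  obtains t m b where "bd T = [end_at t 0, end_at (\<not> m) 3, end_at (\<not> b) 6, end_at (\<not> t) 2,
      end_at m 5, end_at b 8]"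
    "boundary_colorings T =
      {[x0, x3, x6, x2, x5, x8] | x0 x3 x6 x2 x5 x8. \<exists>x1 x4 x7. crossing t m x3 x4 x0 x1 \<and>
      crossing t b x6 x7 x1 x2 \<and>
      crossing (\<not> m) b x7 x8 x4 x5}"
    "determined T"
  by (rule oriented_triangle_1'[OF assms], rule that, assumption, rule set_eqI)
    ((simp add: boundary_coloring_simps; blast),
        auto simp: determined_simps oriented_arcs[OF assms] dest: determined_dests)

lemma colorings_triangle_2:
  assumes "orients T ([UX 4 2 5 1, UX 7 1 8 0, UX 3 6 4 7], [0, 3, 6, 2, 5, 8])"
  obtains t m b where "bd T = [end_at t 0, end_at (\<not> b) 3, end_at (\<not> m) 6, end_at (\<not> t) 2,
      end_at b 5, end_at m 8]"
    "boundary_colorings T =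
      {[x0, x3, x6, x2, x5, x8] | x0 x3 x6 x2 x5 x8. \<exists>x1 x4 x7. crossing t b x4 x5 x1 x2 \<and>
      crossing t m x7 x8 x0 x1 \<and>
      crossing m b x3 x4 x7 x6}"
    "determined T"
  by (rule oriented_triangle_2[OF assms], rule that, assumption, rule set_eqI)
    ((simp add: boundary_coloring_simps; blast),
        auto simp: determined_simps oriented_arcs[OF assms] dest: determined_dests)

lemma colorings_triangle_2':
  assumes "orients T ([UX 3 1 4 0, UX 6 2 7 1, UX 4 7 5 8], [0, 3, 6, 2, 5, 8])"
  obtains t m b where "bd T = [end_at t 0, end_at (\<not> b) 3, end_at (\<not> m) 6, end_at (\<not> t) 2,
      end_at b 5, end_at m 8]"
    "boundary_colorings T =
      {[x0, x3, x6, x2, x5, x8] | x0 x3 x6 x2 x5 x8. \<exists>x1 x4 x7. crossing t b x3 x4 x0 x1 \<and>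
      crossing t m x6 x7 x1 x2 \<and>
      crossing m b x4 x5 x8 x7}"
    "determined T"
  by (rule oriented_triangle_2'[OF assms], rule that, assumption, rule set_eqI)
    ((simp add: boundary_coloring_simps; blast),
        auto simp: determined_simps oriented_arcs[OF assms] dest: determined_dests)

lemma colorings_over_pass:
  assumes "orients T ([UV 4 5 2, UX 2 1 3 0], [0, 4, 5, 1, 3])"
  obtains a b d s where "bd T = [end_at s 0, end_at (\<not> a) 4, end_at (\<not> b) 5, end_at (\<not> s) 1,
      end_at (\<not> d) 3]"
    "boundary_colorings T =
      {[x0, x4, x5, x1, x3] | x0 x4 x5 x1 x3. \<exists>x2. cycle (flow d x2) (flow b x5) (flow a x4) \<and>
      crossing s (\<not> d) x2 x3 x0 x1}"
    "determined T"
  by (rule oriented_over_pass[OF assms], rule that, assumption, rule set_eqI)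
    ((simp add: boundary_coloring_simps; blast),
        auto simp: determined_simps oriented_arcs[OF assms] dest: determined_dests)

lemma colorings_over_pass':
  assumes "orients T ([UV 4 6 7, UX 3 1 4 0, UX 5 2 6 1], [0, 3, 5, 2, 7])"
  obtains a b d s where "bd T = [end_at s 0, end_at (\<not> a) 3, end_at (\<not> b) 5, end_at (\<not> s) 2,
      end_at (\<not> d) 7]"
    "boundary_colorings T =
      {[x0, x3, x5, x2, x7] | x0 x3 x5 x2 x7. \<exists>x1 x4 x6. cycle (flow d x7) (flow b x6) (flow a x4) \<and>
      crossing s a x3 x4 x0 x1 \<and>
      crossing s b x5 x6 x1 x2}"
    "determined T"
  by (rule oriented_over_pass'[OF assms], rule that, assumption, rule set_eqI)
    ((simp add: boundary_coloring_simps; blast),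
        auto simp: determined_simps oriented_arcs[OF assms] dest: determined_dests)

lemma colorings_under_pass:
  assumes "orients T ([UV 4 5 2, UX 0 2 1 3], [0, 4, 5, 1, 3])"
  obtains a b d s where "bd T = [end_at (\<not> s) 0, end_at (\<not> a) 4, end_at (\<not> b) 5, end_at s 1,
      end_at (\<not> d) 3]"
    "boundary_colorings T =
      {[x0, x4, x5, x1, x3] | x0 x4 x5 x1 x3. \<exists>x2. cycle (flow d x2) (flow b x5) (flow a x4) \<and>
      crossing (\<not> d) s x0 x1 x3 x2}"
    "determined T"
  by (rule oriented_under_pass[OF assms], rule that, assumption, rule set_eqI)
    ((simp add: boundary_coloring_simps; blast),
        auto simp: determined_simps oriented_arcs[OF assms] dest: determined_dests)

lemma colorings_under_pass':
  assumes "orients T ([UV 4 6 7, UX 0 3 1 4, UX 1 5 2 6], [0, 3, 5, 2, 7])"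
  obtains a b d s where "bd T = [end_at (\<not> s) 0, end_at (\<not> a) 3, end_at (\<not> b) 5, end_at s 2,
      end_at (\<not> d) 7]"
    "boundary_colorings T =
      {[x0, x3, x5, x2, x7] | x0 x3 x5 x2 x7. \<exists>x1 x4 x6. cycle (flow d x7) (flow b x6) (flow a x4) \<and>
      crossing a s x0 x1 x4 x3 \<and>
      crossing b s x1 x2 x6 x5}"
    "determined T"
  by (rule oriented_under_pass'[OF assms], rule that, assumption, rule set_eqI)
    ((simp add: boundary_coloring_simps; blast),
        auto simp: determined_simps oriented_arcs[OF assms] dest: determined_dests)

lemma colorings_vertex:
  assumes "orients T ([UV 0 1 2], [0, 1, 2])"
  obtains a b d where "bd T = [end_at (\<not> a) 0, end_at (\<not> b) 1, end_at (\<not> d) 2]"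
    "boundary_colorings T =
      {[x0, x1, x2] | x0 x1 x2. cycle (flow d x2) (flow b x1) (flow a x0)}"
    "determined T"
  by (rule oriented_vertex[OF assms], rule that, assumption, rule set_eqI)
    ((simp add: boundary_coloring_simps; blast),
        auto simp: determined_simps oriented_arcs[OF assms] dest: determined_dests)

lemma colorings_twist:
  assumes "orients T ([UV 3 4 2, UX 1 4 3 0], [0, 1, 2])"
  obtains a b d where "bd T = [end_at (\<not> a) 0, end_at (\<not> b) 1, end_at (\<not> d) 2]"
    "boundary_colorings T =
      {[x0, x1, x2] | x0 x1 x2. \<exists>x3 x4. cycle (flow d x2) (flow a x4) (flow b x3) \<and>
      crossing (\<not> a) b x1 x3 x0 x4}"
    "determined T"
  by (rule oriented_twist[OF assms], rule that, assumption, rule set_eqI)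
    ((simp add: boundary_coloring_simps; blast),
        auto simp: determined_simps oriented_arcs[OF assms] dest: determined_dests)

lemma colorings_twist':
  assumes "orients T ([UV 3 4 2, UX 0 1 4 3], [0, 1, 2])"
  obtains a b d where "bd T = [end_at (\<not> a) 0, end_at (\<not> b) 1, end_at (\<not> d) 2]"
    "boundary_colorings T =
      {[x0, x1, x2] | x0 x1 x2. \<exists>x3 x4. cycle (flow d x2) (flow a x4) (flow b x3) \<and>
      crossing b a x0 x4 x3 x1}"
    "determined T"
  by (rule oriented_twist'[OF assms], rule that, assumption, rule set_eqI)
    ((simp add: boundary_coloring_simps; blast),
        auto simp: determined_simps oriented_arcs[OF assms] dest: determined_dests)

lemma colorings_H:
  assumes "orients T ([UV 0 1 4, UV 2 3 4], [0, 1, 2, 3])"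
  obtains a b p q e where "bd T = [end_at (\<not> a) 0, end_at (\<not> b) 1, end_at (\<not> p) 2, end_at (\<not> q) 3]"
    "boundary_colorings T =
      {[x0, x1, x2, x3] | x0 x1 x2 x3. \<exists>x4. cycle (flow e x4) (flow b x1) (flow a x0) \<and>
      cycle (flow (\<not> e) x4) (flow q x3) (flow p x2)}"
    "determined T"
  by (rule oriented_H[OF assms], rule that, assumption, rule set_eqI)
    ((simp add: boundary_coloring_simps; blast),
        auto simp: determined_simps oriented_arcs[OF assms] dest: determined_dests)

lemma colorings_I:
  assumes "orients T ([UV 1 2 4, UV 3 0 4], [0, 1, 2, 3])"
  obtains a b p q e where "bd T = [end_at (\<not> a) 0, end_at (\<not> b) 1, end_at (\<not> p) 2, end_at (\<not> q) 3]"
    "boundary_colorings T =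
      {[x0, x1, x2, x3] | x0 x1 x2 x3. \<exists>x4. cycle (flow e x4) (flow p x2) (flow b x1) \<and>
      cycle (flow (\<not> e) x4) (flow a x0) (flow q x3)}"
    "determined T"
  by (rule oriented_I[OF assms], rule that, assumption, rule set_eqI)
    ((simp add: boundary_coloring_simps; blast),
        auto simp: determined_simps oriented_arcs[OF assms] dest: determined_dests)

lemmas boundary_simps = list.map end_at_simps list.inject simp_thms

text \<open>As the directions at the circle are the same on both sides, so are the bits of the two
  pictures (except those of the inner edges of an IH move), and each case is one of the
  equivalences above.\<close>

lemma boundary_colorings_move:
  assumes "(P, P') \<in> moves" "orients T P" "orients T' P'"
    "map is_head (bd T) = map is_head (bd T')"
  shows "boundary_colorings T = boundary_colorings T' \<and> determined T \<and> determined T'"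
proof -
  from assms(1) consider
    (kink) "P = ([], [0, 0])" "P' = ([UX 0 1 1 2], [0, 2])"
  | (kink') "P = ([], [0, 0])" "P' = ([UX 0 2 1 1], [0, 2])"
  | (undo) "P = ([], [0, 1, 1, 0])" "P' = ([UX 1 2 4 0, UX 4 2 5 3], [0, 1, 5, 3])"
  | (triangle_1) "P = ([UX 4 2 5 1, UX 7 1 8 0, UX 6 4 7 3], [0, 3, 6, 2, 5, 8])"
      "P' = ([UX 3 1 4 0, UX 6 2 7 1, UX 7 5 8 4], [0, 3, 6, 2, 5, 8])"
  | (triangle_2) "P = ([UX 4 2 5 1, UX 7 1 8 0, UX 3 6 4 7], [0, 3, 6, 2, 5, 8])"
      "P' = ([UX 3 1 4 0, UX 6 2 7 1, UX 4 7 5 8], [0, 3, 6, 2, 5, 8])"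
  | (over_pass) "P = ([UV 4 5 2, UX 2 1 3 0], [0, 4, 5, 1, 3])"
      "P' = ([UV 4 6 7, UX 3 1 4 0, UX 5 2 6 1], [0, 3, 5, 2, 7])"
  | (under_pass) "P = ([UV 4 5 2, UX 0 2 1 3], [0, 4, 5, 1, 3])"
      "P' = ([UV 4 6 7, UX 0 3 1 4, UX 1 5 2 6], [0, 3, 5, 2, 7])"
  | (twist) "P = ([UV 0 1 2], [0, 1, 2])" "P' = ([UV 3 4 2, UX 1 4 3 0], [0, 1, 2])"
  | (twist') "P = ([UV 0 1 2], [0, 1, 2])" "P' = ([UV 3 4 2, UX 0 1 4 3], [0, 1, 2])"
  | (IH) "P = ([UV 0 1 4, UV 2 3 4], [0, 1, 2, 3])" "P' = ([UV 1 2 4, UV 3 0 4], [0, 1, 2, 3])"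
    unfolding moves_def reidemeister1_def reidemeister2_def reidemeister3_def
      vertex_pass_def vertex_twist_def IH_move_def
    by (elim UnE insertE emptyE) simp_all
  then show ?thesis
  proof cases
    case kink
    show ?thesis using assms(2-4) unfolding kink
      by (elim colorings_arc colorings_kink)
        (simp only: boundary_simps, clarify?, simp only: kink_move, blast)
  next
    case kink'
    show ?thesis using assms(2-4) unfolding kink'
      by (elim colorings_arc colorings_kink')
        (simp only: boundary_simps, clarify?, simp only: kink_move', blast)
  next
    case undo
    show ?thesis using assms(2-4) unfolding undo
      by (elim colorings_two_arcs colorings_two_crossings)
        (simp only: boundary_simps, clarify?, simp only: undo_move, blast)
  next
    case triangle_1
    show ?thesis using assms(2-4) unfolding triangle_1
      by (elim colorings_triangle_1 colorings_triangle_1')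
        (simp only: boundary_simps, clarify?, simp only: triangle_move_1)
  next
    case triangle_2
    show ?thesis using assms(2-4) unfolding triangle_2
      by (elim colorings_triangle_2 colorings_triangle_2')
        (simp only: boundary_simps, clarify?, simp only: triangle_move_2)
  next
    case over_pass
    show ?thesis using assms(2-4) unfolding over_pass
      by (elim colorings_over_pass colorings_over_pass')
        (simp only: boundary_simps, clarify?, simp only: over_pass_move)
  next
    case under_pass
    show ?thesis using assms(2-4) unfolding under_pass
      by (elim colorings_under_pass colorings_under_pass')
        (simp only: boundary_simps, clarify?, simp only: under_pass_move)
  next
    case twist
    show ?thesis using assms(2-4) unfolding twist
      by (elim colorings_vertex colorings_twist)
        (simp only: boundary_simps, clarify?, simp only: twist_move)
  next
    case twist'
    show ?thesis using assms(2-4) unfolding twist'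
      by (elim colorings_vertex colorings_twist')
        (simp only: boundary_simps, clarify?, simp only: twist_move')
  next
    case IH
    show ?thesis using assms(2-4) unfolding IH
      by (elim colorings_H colorings_I)
        (simp only: boundary_simps, clarify?, (simp only: simp_thms)?,
        intro IH_move_algebra Collect_cong ex_cong1 conj_cong refl)
  qed
qed

end

section \<open>Gluing colorings\<close>

lemma colored_node_map: "colored_node ut ot D m c (map_node h n) \<longleftrightarrow> colored_node ut ot D m (c \<circ> h) n"
  by (cases n) simp_all

lemma colored_node_cong:
  "(\<And>e. e \<in> semiarc ` set (ccw n) \<Longrightarrow> c e = d e) \<Longrightarrow>
    colored_node ut ot D m c n \<longleftrightarrow> colored_node ut ot D m d n"
  by (cases n) simp_all

lemma tangle_arcs:
  assumes "is_tangle T"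
  shows "n \<in> nodes T \<Longrightarrow> semiarc ` set (ccw n) \<subseteq> arcs T" "semiarc ` set (bd T) \<subseteq> arcs T"
  using assms by (auto simp: is_tangle_def attached_def)

lemma glue_length: "glue E T G f g \<Longrightarrow> length (bd T) = length (bd E)"
  by (auto simp: glue_def dest: list_all2_lengthD)

lemma glue_joint:
  assumes "glue E T G f g" "is_tangle E" "is_tangle T" "i < length (bd E)"
  shows "f (semiarc (bd E ! i)) = g (semiarc (bd T ! i))"
proof -
  let ?p = "Inl (semiarc (bd E ! i))" and ?q = "Inr (semiarc (bd T ! i))"
  have "?p \<in> arcs E <+> arcs T" "?q \<in> arcs E <+> arcs T"
    using assms(4) tangle_arcs(2)[OF assms(2)] tangle_arcs(2)[OF assms(3)] glue_length[OF assms(1)]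
    by (auto simp: image_subset_iff)
  moreover have "(?p, ?q) \<in> (joints E T \<union> (joints E T)\<inverse>)\<^sup>*"
    using assms(4) by (auto simp: joints_def)
  ultimately have "case_sum f g ?p = case_sum f g ?q"
    using assms(1) unfolding glue_def by blast
  then show ?thesis by simp
qed

lemma coloring_restrict:
  assumes "glue E T G f g" "is_tangle E" "is_tangle T" "coloring ut ot D m G c"
  shows "\<forall>n\<in>nodes E. colored_node ut ot D m (c \<circ> f) n"
    and "\<forall>n\<in>nodes T. colored_node ut ot D m (c \<circ> g) n"
    and "map (c \<circ> f \<circ> semiarc) (bd E) = map (c \<circ> g \<circ> semiarc) (bd T)"
proof -
  have "\<forall>n\<in>map_node f ` nodes E \<union> map_node g ` nodes T. colored_node ut ot D m c n"
    using assms(1,4) by (auto simp: glue_def coloring_def)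
  then show "\<forall>n\<in>nodes E. colored_node ut ot D m (c \<circ> f) n"
    "\<forall>n\<in>nodes T. colored_node ut ot D m (c \<circ> g) n"
    by (simp_all add: ball_Un colored_node_map)
  show "map (c \<circ> f \<circ> semiarc) (bd E) = map (c \<circ> g \<circ> semiarc) (bd T)"
    using glue_joint[OF assms(1-3)] glue_length[OF assms(1)] by (auto intro: nth_equalityI)
qed

text \<open>Pieces of the same semiarc are connected by a chain of joints, along which the given colors
  are constant; so each semiarc may take the color of any of its pieces.\<close>

lemma coloring_glue:
  assumes glue: "glue E T G f g" and "is_tangle E" "is_tangle T"
    and a: "\<forall>n\<in>nodes E. colored_node ut ot D m a n" and b: "\<forall>n\<in>nodes T. colored_node ut ot D m b n"
    and bd: "map (a \<circ> semiarc) (bd E) = map (b \<circ> semiarc) (bd T)"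
  obtains c where "coloring ut ot D m G c"
    "\<forall>e\<in>arcs E. c (f e) = a e" "\<forall>e\<in>arcs T. c (g e) = b e"
proof -
  let ?A = "arcs E <+> arcs T" and ?h = "case_sum f g" and ?ab = "case_sum a b"
  have joint: "?ab p = ?ab q" if "(p, q) \<in> joints E T \<union> (joints E T)\<inverse>" for p q
  proof -
    have "a (semiarc (bd E ! i)) = b (semiarc (bd T ! i))" if "i < length (bd E)" for i
      using arg_cong[OF bd, of "\<lambda>l. l ! i"] that glue_length[OF glue] by simp
    then show ?thesis using that by (auto simp: joints_def)
  qed
  have "?ab p = ?ab q" if "(p, q) \<in> (joints E T \<union> (joints E T)\<inverse>)\<^sup>*" for p q
    using that by (induction rule: rtrancl_induct) (use joint in metis)+
  then have ab: "?ab p = ?ab q" if "p \<in> ?A" "q \<in> ?A" "?h p = ?h q" for p q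
    using glue that unfolding glue_def by blast
  define c where "c e = (if e \<in> arcs G then ?ab (SOME p. p \<in> ?A \<and> ?h p = e) else undefined)" for e
  have arcs: "arcs G = f ` arcs E \<union> g ` arcs T"
    and nodes: "nodes G = map_node f ` nodes E \<union> map_node g ` nodes T"
    using glue by (auto simp: glue_def)
  have c: "c (?h p) = ?ab p" if "p \<in> ?A" for p
  proof -
    have "?h p \<in> arcs G" using that arcs by auto
    moreover define q where "q = (SOME q. q \<in> ?A \<and> ?h q = ?h p)"
    ultimately have "c (?h p) = ?ab q" by (simp only: c_def if_True)
    moreover have "q \<in> ?A \<and> ?h q = ?h p"
      unfolding q_def by (rule someI[of _ p]) (use that in simp)
    ultimately show ?thesis using ab[of q p] that by simp
  qed
  have cE: "\<forall>e\<in>arcs E. c (f e) = a e" and cT: "\<forall>e\<in>arcs T. c (g e) = b e"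
    using c[OF InlI] c[OF InrI] by auto
  have "colored_node ut ot D m (c \<circ> f) n" if "n \<in> nodes E" for n
    using a that cE tangle_arcs(1)[OF \<open>is_tangle E\<close> that] colored_node_cong[of n "c \<circ> f" a]
    by (auto simp: subset_iff)
  moreover have "colored_node ut ot D m (c \<circ> g) n" if "n \<in> nodes T" for n
    using b that cT tangle_arcs(1)[OF \<open>is_tangle T\<close> that] colored_node_cong[of n "c \<circ> g" b]
    by (auto simp: subset_iff)
  ultimately have "coloring ut ot D m G c"
    by (auto simp: coloring_def nodes colored_node_map) (simp add: c_def)
  with cE cT that show thesis by blast
qed

theorem proposition5p2:
  fixes ut ot mult :: "'x \<Rightarrow> 'x \<Rightarrow> 'x" and D :: "('x \<times> 'x) set"
    and G :: "'e tangle" and G' :: "'f tangle" and E :: "'o tangle"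
    and f :: "'o \<Rightarrow> 'e" and f' :: "'o \<Rightarrow> 'f" and c :: "'e \<Rightarrow> 'x"
  assumes "partially_multiplicative_biquandle ut ot D mult"
    and "diagram G" and "coloring ut ot D mult G c"
    and "diagram G'" and "single_move G G' E f f'"
  shows "\<exists>!c'. coloring ut ot D mult G' c' \<and> (\<forall>e\<in>arcs E. c' (f' e) = c (f e))"
proof -
  interpret partially_multiplicative_biquandle ut ot D mult by fact
  obtain P P' T T' g g' where E: "is_tangle E"
    and move: "(P, P') \<in> moves \<union> moves\<inverse>" "orients T P" "orients T' P'"
    and glue: "glue E T G f g" "glue E T' G' f' g'"
    using assms(5) unfolding single_move_def by blast
  have T: "is_tangle T" "is_tangle T'" using move by (auto simp: orients_def)
  have "map is_head (bd T) = map (\<lambda>d. \<not> is_head d) (bd E)" if "glue E T G f g"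
    for T :: "nat tangle" and G :: "'g tangle" and f g
    using that by (auto simp: glue_def list_all2_conv_all_nth intro!: nth_equalityI)
  from this[OF glue(1)] this[OF glue(2)] have "map is_head (bd T) = map is_head (bd T')" by simp
  with move have local_move: "boundary_colorings T = boundary_colorings T'" "determined T'"
    using boundary_colorings_move[of P P' T T'] boundary_colorings_move[of P' P T' T] by auto
  note c = coloring_restrict[OF glue(1) E T(1) assms(3)]
  have "map (c \<circ> f \<circ> semiarc) (bd E) \<in> boundary_colorings T"
    unfolding c(3) boundary_colorings_def using c(2) by blast
  then have "map (c \<circ> f \<circ> semiarc) (bd E) \<in> boundary_colorings T'"
    by (simp only: local_move(1))
  then obtain b where b: "map (c \<circ> f \<circ> semiarc) (bd E) = map (b \<circ> semiarc) (bd T')"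
      "\<forall>n\<in>nodes T'. colored b n"
    unfolding boundary_colorings_def by blast
  obtain c' where c': "coloring ut ot D mult G' c'" "\<forall>e\<in>arcs E. c' (f' e) = (c \<circ> f) e"
    by (rule coloring_glue[OF glue(2) E T(2) _ b(2,1)]) (use c(1) in blast)+
  show ?thesis
  proof (rule ex1I[of _ c'])
    show "coloring ut ot D mult G' c' \<and> (\<forall>e\<in>arcs E. c' (f' e) = c (f e))" using c' by simp
  next
    fix c''
    assume c'': "coloring ut ot D mult G' c'' \<and> (\<forall>e\<in>arcs E. c'' (f' e) = c (f e))"
    note r' = coloring_restrict[OF glue(2) E T(2) c'(1)]
    note r'' = coloring_restrict[OF glue(2) E T(2) c''[THEN conjunct1]]
    have "map (c'' \<circ> f' \<circ> semiarc) (bd E) = map (c' \<circ> f' \<circ> semiarc) (bd E)"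
      using c' c'' tangle_arcs(2)[OF E] by (auto simp: subset_iff)
    then have "map (c'' \<circ> g' \<circ> semiarc) (bd T') = map (c' \<circ> g' \<circ> semiarc) (bd T')"
      using r'(3) r''(3) by simp
    then have "\<forall>e\<in>arcs T'. (c'' \<circ> g') e = (c' \<circ> g') e"
      using local_move(2) r'(2) r''(2) unfolding determined_def by blast
    moreover have "arcs G' = f' ` arcs E \<union> g' ` arcs T'" using glue(2) by (simp add: glue_def)
    ultimately have "c'' e = c' e" if "e \<in> arcs G'" for e
      using that c' c'' by auto
    moreover have "c'' e = c' e" if "e \<notin> arcs G'" for e
      using that c' c'' by (auto simp: coloring_def)
    ultimately show "c'' = c'" by blast
  qed
qed

end
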